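(* Let $X$ be a complete $\mathrm{CAT}(0)$ space satisfying either of the following conditions: (i) $X$ is a (finite or infinite) product of copies of a finite number of spaces each of which is geodesically complete and admits a cocompact proper isometric action of a group; (ii) $X$ is a (finite or infinite) product of uniformly locally doubling $\mathrm{CAT}(0)$ spaces with a common doubling constant. Then a sequence of expanders does not embed coarsely into $X$ (i.e. no sequence of expanders embeds coarsely into $X$).
   Context: Standing assumptions: every graph $G=(V,E)$ is simple, connected, and satisfies $2\le|V|<\infty$; every metric space contains at least two points. $\mu_1(G)$ is the first positive eigenvalue of the combinatorial Laplacian $\Delta f(v)=f(v)-\frac{1}{\deg(v)}\sum_{u:\{u,v\}\in E}f(u)$ on functions $f:V\to\mathbb{R}$. Sequence of expanders: a sequence $\{G_\ell=(V_\ell,E_\ell)\}_{\ell\in L}$ of graphs indexed by an unbounded set $L$ of positive integers such that (1) $\lim_{\ell\to\infty}|V_\ell|=\infty$; (2) there is $d>0$ with $\deg(u)\le d$ for all $\ell\in L$, $u\in V_\ell$; (3) there is $\lambda>0$ with $\mu_1(G_\ell)\ge\lambda$ for all $\ell\in L$. Coarse embedding of a sequence: let $d_\ell$ be the graph metric on $V_\ell$. The sequence embeds coarsely into $(X,d_X)$ if there exist unbounded nondecreasing functions $\alpha,\beta:[0,\infty)\to[0,\infty)$ and maps $f_\ell:V_\ell\to X$ with $$\alpha(d_\ell(u,v))\le d_X(f_\ell(u),f_\ell(v))\le\beta(d_\ell(u,v))$$ for every $\ell$ and every $u,v\in V_\ell$. Geodesic completeness: a geodesic is an isometric embedding of an interval;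 a local geodesic is a path $\gamma:I\to X$ such that every $t\in I$ has a neighborhood in $I$ on which $\gamma$ is a geodesic. A metric space $X$ is geodesically complete if it is complete and any local geodesic $\gamma:[0,a]\to X$ is a restriction of some local geodesic $\tilde\gamma:[0,b]\to X$ with $0<a<b$. Actions: an isometric action of a group $\Gamma$ on $X$ is cocompact if there is a compact $K\subset X$ with $X=\bigcup_{\gamma\in\Gamma}\gamma K$; it is proper if for each $p\in X$ there is $r>0$ such that $\{\gamma\in\Gamma:\gamma B(p,r)\cap B(p,r)\ne\emptyset\}$ is finite, where $B(p,r)$ is the open ball. Doubling: a metric space is doubling with doubling constant $N\in[1,\infty)$ if every closed ball can be covered by at most $N$ closed balls of half the radius. It is uniformly locally doubling with doubling constant $N$ if any point has a neighborhood which is doubling with doubling constant $N$. Products: for metric spaces $(X_1,d_1),(X_2,d_2),\ldots$ (finitely many or a sequence) with basepoints $o_n\in X_n$, the product is the ($\ell^2$-)product: the set of $(x_n)_n$ with $x_n\in X_n$ and $\sum_n d_n(o_n,x_n)^2<\infty$, with metric $d(x,y)^2=\sum_n d_n(x_n,y_n)^2$. *)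

theory Defs
  imports "HOL-Analysis.Analysis" "HOL-Algebra.Group_Action"
begin

section \<open>Metric spaces\<close>

definition nondegenerate :: "'a metric \<Rightarrow> bool" where
  "nondegenerate X \<longleftrightarrow> (\<exists>x \<in> mspace X. \<exists>y \<in> mspace X. x \<noteq> y)"

definition isometric_spaces :: "'a metric \<Rightarrow> 'b metric \<Rightarrow> bool" where
  "isometric_spaces X Y \<longleftrightarrow>
     (\<exists>h. h ` mspace X = mspace Y \<and>
          (\<forall>x \<in> mspace X. \<forall>y \<in> mspace X. mdist Y (h x) (h y) = mdist X x y))"


subsection \<open>Geodesics and geodesic completeness\<close>

definition geodesic_on :: "'a metric \<Rightarrow> real set \<Rightarrow> (real \<Rightarrow> 'a) \<Rightarrow> bool" where
  "geodesic_on X I \<gamma> \<longleftrightarrow>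
     is_interval I \<and> \<gamma> \<in> I \<rightarrow> mspace X \<and>
     (\<forall>s \<in> I. \<forall>t \<in> I. mdist X (\<gamma> s) (\<gamma> t) = \<bar>s - t\<bar>)"

definition local_geodesic_on :: "'a metric \<Rightarrow> real set \<Rightarrow> (real \<Rightarrow> 'a) \<Rightarrow> bool" where
  "local_geodesic_on X I \<gamma> \<longleftrightarrow>
     is_interval I \<and> (\<forall>t \<in> I. \<exists>e > 0. geodesic_on X (I \<inter> {t - e <..< t + e}) \<gamma>)"

definition geodesically_complete :: "'a metric \<Rightarrow> bool" where
  "geodesically_complete X \<longleftrightarrow>
     mcomplete_of X \<and>
     (\<forall>a > 0. \<forall>\<gamma>. local_geodesic_on X {0..a} \<gamma> \<longrightarrow>
        (\<exists>b > a. \<exists>\<gamma>'. local_geodesic_on X {0..b} \<gamma>' \<and> (\<forall>t \<in> {0..a}. \<gamma>' t = \<gamma> t)))"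


subsection \<open>CAT(0) spaces\<close>

definition geodesic_from_to :: "'a metric \<Rightarrow> 'a \<Rightarrow> 'a \<Rightarrow> (real \<Rightarrow> 'a) \<Rightarrow> bool" where
  "geodesic_from_to X x y \<gamma> \<longleftrightarrow>
     geodesic_on X {0..mdist X x y} \<gamma> \<and> \<gamma> 0 = x \<and> \<gamma> (mdist X x y) = y"

text \<open>
  A geodesic triangle with vertices \<open>x\<close>, \<open>y\<close>, \<open>z\<close> is compared with a Euclidean triangle
  \<open>x'\<close>, \<open>y'\<close>, \<open>z'\<close> with the same side lengths; \<open>p'\<close> and \<open>q'\<close> are the comparison points of
  \<open>\<gamma> s\<close> and \<open>\<delta> t\<close>.  Any two distinct sides of a triangle share a vertex, here called \<open>x\<close>; since the
  labelling of the vertices is arbitrary, all pairs of sides are covered.  (For two points on the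
  same side, the comparison inequality is an equality.)
\<close>

definition CAT0 :: "'a metric \<Rightarrow> bool" where
  "CAT0 X \<longleftrightarrow>
     (\<forall>x \<in> mspace X. \<forall>y \<in> mspace X. \<exists>\<gamma>. geodesic_from_to X x y \<gamma>) \<and>
     (\<forall>x \<in> mspace X. \<forall>y \<in> mspace X. \<forall>z \<in> mspace X. \<forall>\<gamma> \<delta>.
        geodesic_from_to X x y \<gamma> \<longrightarrow> geodesic_from_to X x z \<delta> \<longrightarrow>
        (\<forall>(x' :: real^2) y' z'.
           dist x' y' = mdist X x y \<longrightarrow> dist y' z' = mdist X y z \<longrightarrow> dist x' z' = mdist X x z \<longrightarrow>
           (\<forall>s \<in> {0..mdist X x y}. \<forall>t \<in> {0..mdist X x z}.
              \<forall>p' \<in> closed_segment x' y'. \<forall>q' \<in> closed_segment x' z'.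
                dist x' p' = s \<longrightarrow> dist x' q' = t \<longrightarrow> mdist X (\<gamma> s) (\<delta> t) \<le> dist p' q')))"


subsection \<open>Isometric actions\<close>

definition isometric_action :: "('g, 'm) monoid_scheme \<Rightarrow> 'a metric \<Rightarrow> ('g \<Rightarrow> 'a \<Rightarrow> 'a) \<Rightarrow> bool" where
  "isometric_action \<Gamma> X \<phi> \<longleftrightarrow>
     group_action \<Gamma> (mspace X) \<phi> \<and>
     (\<forall>g \<in> carrier \<Gamma>. \<forall>x \<in> mspace X. \<forall>y \<in> mspace X. mdist X (\<phi> g x) (\<phi> g y) = mdist X x y)"

definition cocompact_action :: "('g, 'm) monoid_scheme \<Rightarrow> 'a metric \<Rightarrow> ('g \<Rightarrow> 'a \<Rightarrow> 'a) \<Rightarrow> bool" where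
  "cocompact_action \<Gamma> X \<phi> \<longleftrightarrow>
     (\<exists>K. compactin (mtopology_of X) K \<and> mspace X = (\<Union>g \<in> carrier \<Gamma>. \<phi> g ` K))"

definition proper_action :: "('g, 'm) monoid_scheme \<Rightarrow> 'a metric \<Rightarrow> ('g \<Rightarrow> 'a \<Rightarrow> 'a) \<Rightarrow> bool" where
  "proper_action \<Gamma> X \<phi> \<longleftrightarrow>
     (\<forall>p \<in> mspace X. \<exists>r > 0. finite {g \<in> carrier \<Gamma>. \<phi> g ` mball_of X p r \<inter> mball_of X p r \<noteq> {}})"


subsection \<open>Doubling\<close>

definition doubling :: "'a metric \<Rightarrow> real \<Rightarrow> bool" where
  "doubling X N \<longleftrightarrow>
     (\<forall>x \<in> mspace X. \<forall>r > 0. \<exists>C \<subseteq> mspace X.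
        finite C \<and> real (card C) \<le> N \<and> mcball_of X x r \<subseteq> (\<Union>c \<in> C. mcball_of X c (r / 2)))"

definition uniformly_locally_doubling :: "'a metric \<Rightarrow> real \<Rightarrow> bool" where
  "uniformly_locally_doubling X N \<longleftrightarrow>
     (\<forall>x \<in> mspace X. \<exists>U W. openin (mtopology_of X) W \<and> x \<in> W \<and> W \<subseteq> U \<and> U \<subseteq> mspace X \<and>
        doubling (submetric X U) N)"


subsection \<open>Products\<close>

text \<open>
  The index set \<open>I\<close> may be finite or infinite; a finite or infinite sequence of factors is the case
  of a set of natural numbers.  The \<open>o\<close> in the usual notation for basepoints is called \<open>p\<close> here.
  The lemmas below confirm that the pair is a metric space, so that \<^const>\<open>metric\<close> is applied
  within its domain.
\<close>

definition l2_prod_carrier :: "'i set \<Rightarrow> ('i \<Rightarrow> 'a metric) \<Rightarrow> ('i \<Rightarrow> 'a) \<Rightarrow> ('i \<Rightarrow> 'a) set" where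
  "l2_prod_carrier I F p =
     {x \<in> \<Pi>\<^sub>E i\<in>I. mspace (F i). (\<lambda>i. (mdist (F i) (p i) (x i))\<^sup>2) summable_on I}"

definition l2_prod_dist :: "'i set \<Rightarrow> ('i \<Rightarrow> 'a metric) \<Rightarrow> ('i \<Rightarrow> 'a) \<Rightarrow> ('i \<Rightarrow> 'a) \<Rightarrow> real" where
  "l2_prod_dist I F x y = sqrt (\<Sum>\<^sub>\<infinity>i\<in>I. (mdist (F i) (x i) (y i))\<^sup>2)"

definition l2_product :: "'i set \<Rightarrow> ('i \<Rightarrow> 'a metric) \<Rightarrow> ('i \<Rightarrow> 'a) \<Rightarrow> ('i \<Rightarrow> 'a) metric" where
  "l2_product I F p = metric (l2_prod_carrier I F p, l2_prod_dist I F)"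

lemma Minkowski_infsum:
  fixes a b c :: "'i \<Rightarrow> real"
  assumes a: "(\<lambda>i. (a i)\<^sup>2) summable_on I" and b: "(\<lambda>i. (b i)\<^sup>2) summable_on I"
    and c: "\<And>i. i \<in> I \<Longrightarrow> 0 \<le> c i" "\<And>i. i \<in> I \<Longrightarrow> c i \<le> a i + b i"
  shows "(\<lambda>i. (c i)\<^sup>2) summable_on I"
    and "sqrt (\<Sum>\<^sub>\<infinity>i\<in>I. (c i)\<^sup>2) \<le> sqrt (\<Sum>\<^sub>\<infinity>i\<in>I. (a i)\<^sup>2) + sqrt (\<Sum>\<^sub>\<infinity>i\<in>I. (b i)\<^sup>2)"
proof -
  let ?S = "sqrt (\<Sum>\<^sub>\<infinity>i\<in>I. (a i)\<^sup>2) + sqrt (\<Sum>\<^sub>\<infinity>i\<in>I. (b i)\<^sup>2)"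
  have S0: "0 \<le> ?S"
    by (simp add: infsum_nonneg)
  have bnd: "(\<Sum>i\<in>A. (c i)\<^sup>2) \<le> ?S\<^sup>2" if A: "finite A" "A \<subseteq> I" for A
  proof -
    have "L2_set c A \<le> L2_set (\<lambda>i. a i + b i) A"
      using c A by (intro L2_set_mono) auto
    also have "\<dots> \<le> L2_set a A + L2_set b A"
      by (rule L2_set_triangle_ineq)
    also have "\<dots> \<le> ?S"
      unfolding L2_set_def
      by (intro add_mono real_sqrt_le_mono finite_sum_le_infsum a b A) auto
    finally have "(L2_set c A)\<^sup>2 \<le> ?S\<^sup>2"
      by (intro power_mono) auto
    then show ?thesis
      by (simp add: L2_set_def sum_nonneg)
  qed
  show sm: "(\<lambda>i. (c i)\<^sup>2) summable_on I"
    by (rule nonneg_bdd_above_summable_on) (auto intro!: bdd_aboveI2[where M = "?S\<^sup>2"] bnd)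
  have "(\<Sum>\<^sub>\<infinity>i\<in>I. (c i)\<^sup>2) \<le> ?S\<^sup>2"
    by (rule infsum_le_finite_sums[OF sm bnd])
  then show "sqrt (\<Sum>\<^sub>\<infinity>i\<in>I. (c i)\<^sup>2) \<le> ?S"
    using S0 real_le_lsqrt by blast
qed

lemma mdist_triangle_of:
  "\<lbrakk>x \<in> mspace m; y \<in> mspace m; z \<in> mspace m\<rbrakk> \<Longrightarrow> mdist m x z \<le> mdist m x y + mdist m y z"
  by (rule Metric_space.triangle[OF Metric_space_mspace_mdist])

lemma mdist_commute_of: "mdist m x y = mdist m y x"
  by (rule Metric_space.commute[OF Metric_space_mspace_mdist])

lemma mdist_nonneg_of: "0 \<le> mdist m x y"
  by (rule Metric_space.nonneg[OF Metric_space_mspace_mdist])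

lemma l2_prod_summable:
  assumes p: "\<And>i. i \<in> I \<Longrightarrow> p i \<in> mspace (F i)"
    and x: "x \<in> l2_prod_carrier I F p" and y: "y \<in> l2_prod_carrier I F p"
  shows "(\<lambda>i. (mdist (F i) (x i) (y i))\<^sup>2) summable_on I"
proof (rule Minkowski_infsum(1))
  show "(\<lambda>i. (mdist (F i) (p i) (x i))\<^sup>2) summable_on I"
    "(\<lambda>i. (mdist (F i) (p i) (y i))\<^sup>2) summable_on I"
    using x y by (auto simp: l2_prod_carrier_def)
  show "mdist (F i) (x i) (y i) \<le> mdist (F i) (p i) (x i) + mdist (F i) (p i) (y i)"
    if "i \<in> I" for i
    using that p x y mdist_triangle_of[of "x i" "F i" "p i" "y i"]
    by (auto simp: l2_prod_carrier_def PiE_iff mdist_commute_of[of "F i" "x i" "p i"])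
qed (rule mdist_nonneg_of)

lemma Metric_space_l2_prod:
  assumes p: "\<And>i. i \<in> I \<Longrightarrow> p i \<in> mspace (F i)"
  shows "Metric_space (l2_prod_carrier I F p) (l2_prod_dist I F)"
proof
  fix x y
  show "0 \<le> l2_prod_dist I F x y"
    by (simp add: l2_prod_dist_def infsum_nonneg)
  show "l2_prod_dist I F x y = l2_prod_dist I F y x"
    by (simp add: l2_prod_dist_def mdist_commute_of[of _ "x _"])
next
  fix x y assume x: "x \<in> l2_prod_carrier I F p" and y: "y \<in> l2_prod_carrier I F p"
  have mem: "x i \<in> mspace (F i)" "y i \<in> mspace (F i)" if "i \<in> I" for i
    using x y that by (auto simp: l2_prod_carrier_def)
  show "l2_prod_dist I F x y = 0 \<longleftrightarrow> x = y"
  proof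
    assume "l2_prod_dist I F x y = 0"
    then have "(\<Sum>\<^sub>\<infinity>i\<in>I. (mdist (F i) (x i) (y i))\<^sup>2) \<le> 0"
      by (simp add: l2_prod_dist_def)
    then have "(mdist (F i) (x i) (y i))\<^sup>2 = 0" if "i \<in> I" for i
      by (rule nonneg_infsum_le_0D[OF _ l2_prod_summable[OF p x y] _ that]) auto
    then have "x i = y i" if "i \<in> I" for i
      using that mem by (simp add: Metric_space.zero[OF Metric_space_mspace_mdist])
    then show "x = y"
      using x y unfolding l2_prod_carrier_def by (blast intro: PiE_ext)
  next
    assume "x = y"
    then show "l2_prod_dist I F x y = 0"
      using mem by (auto simp: l2_prod_dist_def Metric_space.zero[OF Metric_space_mspace_mdist]
          intro!: infsum_0)
  qed
next
  fix x y z
  assume x: "x \<in> l2_prod_carrier I F p" and y: "y \<in> l2_prod_carrier I F p"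
    and z: "z \<in> l2_prod_carrier I F p"
  show "l2_prod_dist I F x z \<le> l2_prod_dist I F x y + l2_prod_dist I F y z"
    unfolding l2_prod_dist_def
    using x y z
    by (intro Minkowski_infsum(2) l2_prod_summable[OF p x y] l2_prod_summable[OF p y z]
        mdist_nonneg_of mdist_triangle_of) (auto simp: l2_prod_carrier_def)
qed

lemma mspace_l2_product:
  "(\<And>i. i \<in> I \<Longrightarrow> p i \<in> mspace (F i)) \<Longrightarrow> mspace (l2_product I F p) = l2_prod_carrier I F p"
  by (simp add: l2_product_def Metric_space.mspace_metric Metric_space_l2_prod)

lemma mdist_l2_product:
  "(\<And>i. i \<in> I \<Longrightarrow> p i \<in> mspace (F i)) \<Longrightarrow> mdist (l2_product I F p) = l2_prod_dist I F"
  by (simp add: l2_product_def Metric_space.mdist_metric Metric_space_l2_prod)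


section \<open>Graphs and expanders\<close>

text \<open>
  A graph is given by its vertex set \<open>V\<close> and its edge set \<open>E\<close>, a set of two-element subsets of \<open>V\<close>.
\<close>

definition adj :: "'v set set \<Rightarrow> ('v \<times> 'v) set" where
  "adj E = {(u, v). {u, v} \<in> E}"

definition finite_connected_graph :: "'v set \<Rightarrow> 'v set set \<Rightarrow> bool" where
  "finite_connected_graph V E \<longleftrightarrow>
     finite V \<and> 2 \<le> card V \<and>
     E \<subseteq> {{u, v} |u v. u \<in> V \<and> v \<in> V \<and> u \<noteq> v} \<and>
     (\<forall>u \<in> V. \<forall>v \<in> V. (u, v) \<in> (adj E)\<^sup>*)"

definition deg :: "'v set set \<Rightarrow> 'v \<Rightarrow> nat" where
  "deg E v = card {u. {u, v} \<in> E}"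

definition graph_dist :: "'v set set \<Rightarrow> 'v \<Rightarrow> 'v \<Rightarrow> nat" where
  "graph_dist E u v = (LEAST n. (u, v) \<in> adj E ^^ n)"

definition laplacian :: "'v set set \<Rightarrow> ('v \<Rightarrow> real) \<Rightarrow> 'v \<Rightarrow> real" where
  "laplacian E f v = f v - (1 / real (deg E v)) * (\<Sum>u | {u, v} \<in> E. f u)"

text \<open>
  Functions on \<open>V\<close> are represented by total functions whose values outside \<open>V\<close> are irrelevant.
\<close>

definition laplacian_eigenvalue :: "'v set \<Rightarrow> 'v set set \<Rightarrow> real \<Rightarrow> bool" where
  "laplacian_eigenvalue V E c \<longleftrightarrow>
     (\<exists>f. (\<exists>v \<in> V. f v \<noteq> 0) \<and> (\<forall>v \<in> V. laplacian E f v = c * f v))"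

definition mu1 :: "'v set \<Rightarrow> 'v set set \<Rightarrow> real" where
  "mu1 V E = (LEAST c. 0 < c \<and> laplacian_eigenvalue V E c)"

definition expander_sequence :: "nat set \<Rightarrow> (nat \<Rightarrow> 'v set) \<Rightarrow> (nat \<Rightarrow> 'v set set) \<Rightarrow> bool" where
  "expander_sequence L V E \<longleftrightarrow>
     infinite L \<and> 0 \<notin> L \<and>
     (\<forall>l \<in> L. finite_connected_graph (V l) (E l)) \<and>
     filterlim (\<lambda>l. card (V l)) at_top (inf sequentially (principal L)) \<and>
     (\<exists>d > 0. \<forall>l \<in> L. \<forall>u \<in> V l. deg (E l) u \<le> d) \<and>
     (\<exists>c > 0. \<forall>l \<in> L. mu1 (V l) (E l) \<ge> c)"

definition unbounded_nondecreasing :: "(real \<Rightarrow> real) \<Rightarrow> bool" where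
  "unbounded_nondecreasing \<alpha> \<longleftrightarrow>
     \<alpha> \<in> {0..} \<rightarrow> {0..} \<and> mono_on {0..} \<alpha> \<and> \<not> bdd_above (\<alpha> ` {0..})"

definition embeds_coarsely ::
    "nat set \<Rightarrow> (nat \<Rightarrow> 'v set) \<Rightarrow> (nat \<Rightarrow> 'v set set) \<Rightarrow> 'a metric \<Rightarrow> bool" where
  "embeds_coarsely L V E X \<longleftrightarrow>
     (\<exists>\<alpha> \<beta> f. unbounded_nondecreasing \<alpha> \<and> unbounded_nondecreasing \<beta> \<and>
        (\<forall>l \<in> L. f l \<in> V l \<rightarrow> mspace X \<and>
           (\<forall>u \<in> V l. \<forall>v \<in> V l.
              \<alpha> (real (graph_dist (E l) u v)) \<le> mdist X (f l u) (f l v) \<and>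
              mdist X (f l u) (f l v) \<le> \<beta> (real (graph_dist (E l) u v)))))"

end

theory Submission
  imports Defs
begin

text \<open>
  The idea is that expanders satisfy a Poincare inequality for maps into \<open>X\<close>: the average of the
  squared distance between the images of two random vertices is at most a constant times the average
  squared length of the images of the edges.  A coarse embedding bounds the latter, whereas most
  pairs of vertices of a large graph of bounded degree are far apart, so that the former is unbounded
  (\<open>no_coarse_embedding_of_expanders\<close>).  For real-valued functions the Poincare inequality is the
  variational characterization of the spectral gap (\<open>mu1_le_rayleigh\<close>, \<open>poincare_real\<close>).

  Since squared distances add up in an l2-product, it suffices to prove the inequality for
  the factors, with a common constant (\<open>poincare_l2_product\<close>).  The factors are complete CAT(0) spaces,
  as 1-Lipschitz retracts of \<open>X\<close>.

  In a complete CAT(0) space \<open>Y\<close>, the inequality follows from the one for real-valued functions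
  if sufficiently small balls around every point, of radius \<open>s\<close> say, are covered by \<open>M\<close> balls of
  radius \<open>s / 4\<close> (\<open>CAT0_poincare\<close>); the constant depends on \<open>M\<close> only.  The reason is that a map whose
  energy is small compared with its spread around the barycentre would concentrate, when it is
  contracted towards the barycentre into such a small ball, near a single point away from the
  barycentre, and moving the barycentre towards that point would decrease the sum of squared distances.

  The covering condition is immediate for uniformly locally doubling spaces.  For a geodesically
  complete space with a proper cocompact action, compactness gives coverings at one fixed scale, and
  they are carried to smaller scales by contracting along geodesics, which can be extended to
  the fixed scale (\<open>cocompact_proper_small_scale_covering\<close>).
\<close>

section \<open>CAT(0) geometry\<close>

text \<open>
  The point at fraction \<open>t\<close> of a chosen geodesic from \<open>b\<close> to \<open>p\<close>.  As a function of \<open>p\<close> it is the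
  homothety with centre \<open>b\<close> and ratio \<open>t\<close>; in a CAT(0) space the choice of the geodesic is
  immaterial, by the lemma \<open>geopt_unique\<close> below.
\<close>

definition geopt :: "'a metric \<Rightarrow> 'a \<Rightarrow> real \<Rightarrow> 'a \<Rightarrow> 'a" where
  "geopt Y b t p = (SOME \<gamma>. geodesic_from_to Y b p \<gamma>) (t * mdist Y b p)"

lemma comparison_triangle:
  fixes a b c :: real
  assumes "0 \<le> a" "0 \<le> b" "0 \<le> c" "a \<le> b + c" "b \<le> a + c" "c \<le> a + b"
  obtains x y z :: "real^2" where "dist x y = a" "dist y z = b" "dist x z = c"
proof -
  \<comment> \<open>The vertex \<open>x\<close> is put at the origin and \<open>y\<close> on the first axis; \<open>u\<close> is the first coordinate of \<open>z\<close>,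
    by the law of cosines.  If \<open>a = 0\<close>, then \<open>x = y\<close> and every point at distance \<open>c\<close> will do.\<close>
  define u where "u = (if a = 0 then c else (a\<^sup>2 + c\<^sup>2 - b\<^sup>2) / (2 * a))"
  have au: "2 * a * u = a\<^sup>2 + c\<^sup>2 - b\<^sup>2"
    using assms by (auto simp: u_def)
  have uc: "u\<^sup>2 \<le> c\<^sup>2"
  proof (cases "a = 0")
    case False
    have "(a\<^sup>2 + c\<^sup>2 - b\<^sup>2) \<le> 2 * a * c"
    proof -
      have "\<bar>a - c\<bar>\<^sup>2 \<le> b\<^sup>2" using assms by (intro power_mono) auto
      then show ?thesis by (simp add: power2_eq_square algebra_simps)
    qed
    moreover have "- (2 * a * c) \<le> a\<^sup>2 + c\<^sup>2 - b\<^sup>2"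
    proof -
      have "b\<^sup>2 \<le> (a + c)\<^sup>2" using assms by (intro power_mono) auto
      then show ?thesis by (simp add: power2_eq_square algebra_simps)
    qed
    ultimately have "\<bar>2 * a * u\<bar> \<le> 2 * a * c" using au by auto
    then have "\<bar>u\<bar> \<le> c" using False assms by (simp add: abs_mult)
    then show ?thesis using assms by (simp add: abs_le_square_iff[symmetric])
  qed (simp add: u_def)
  define v where "v = sqrt (c\<^sup>2 - u\<^sup>2)"
  have v2: "v\<^sup>2 = c\<^sup>2 - u\<^sup>2" using uc by (simp add: v_def)
  show thesis
  proof (rule that[of "0" "vector [a, 0]" "vector [u, v]"])
    have d: "dist (p :: real^2) q = sqrt ((p$1 - q$1)\<^sup>2 + (p$2 - q$2)\<^sup>2)" for p q
      by (simp add: dist_vec_def L2_set_def sum_2 dist_real_def)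
    show "dist (0::real^2) (vector [a, 0]) = a" using assms by (simp add: d)
    show "dist (0::real^2) (vector [u, v]) = c" using assms v2 by (simp add: d)
    have "(a - u)\<^sup>2 + v\<^sup>2 = b\<^sup>2" using v2 au by (simp add: power2_eq_square algebra_simps)
    then show "dist (vector [a, 0] :: real^2) (vector [u, v]) = b" using assms by (simp add: d)
  qed
qed

context
  fixes Y :: "'a metric"
  assumes C: "CAT0 Y"
begin

lemma geopt_geodesic:
  assumes "b \<in> mspace Y" "p \<in> mspace Y"
  obtains \<gamma> where "geodesic_from_to Y b p \<gamma>" "\<And>t. geopt Y b t p = \<gamma> (t * mdist Y b p)"
proof -
  have "\<exists>\<gamma>. geodesic_from_to Y b p \<gamma>"
    using C assms by (simp add: CAT0_def)
  then have "geodesic_from_to Y b p (SOME \<gamma>. geodesic_from_to Y b p \<gamma>)"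
    by (rule someI_ex)
  then show thesis by (rule that) (simp add: geopt_def)
qed

lemma geodesic_from_to_dist:
  assumes "geodesic_from_to Y b p \<gamma>" "t \<in> {0..1}"
  shows "\<gamma> (t * mdist Y b p) \<in> mspace Y"
    "mdist Y b (\<gamma> (t * mdist Y b p)) = t * mdist Y b p"
    "mdist Y p (\<gamma> (t * mdist Y b p)) = (1 - t) * mdist Y b p"
proof -
  have D: "0 \<le> mdist Y b p" by (rule mdist_nonneg_of)
  have t: "t * mdist Y b p \<in> {0..mdist Y b p}"
    using assms D by (auto intro: mult_left_le_one_le)
  have g: "geodesic_on Y {0..mdist Y b p} \<gamma>" "\<gamma> 0 = b" "\<gamma> (mdist Y b p) = p"
    using assms by (auto simp: geodesic_from_to_def)
  show "\<gamma> (t * mdist Y b p) \<in> mspace Y" using g t by (auto simp: geodesic_on_def)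
  have "mdist Y (\<gamma> 0) (\<gamma> (t * mdist Y b p)) = \<bar>0 - t * mdist Y b p\<bar>"
    using g t D unfolding geodesic_on_def by (metis atLeastAtMost_iff order_refl)
  then show "mdist Y b (\<gamma> (t * mdist Y b p)) = t * mdist Y b p"
    using g D assms by simp
  have "mdist Y (\<gamma> (mdist Y b p)) (\<gamma> (t * mdist Y b p)) = \<bar>mdist Y b p - t * mdist Y b p\<bar>"
    using g t D unfolding geodesic_on_def by (metis atLeastAtMost_iff order_refl)
  then show "mdist Y p (\<gamma> (t * mdist Y b p)) = (1 - t) * mdist Y b p"
    using g t by (simp add: algebra_simps)
qed

lemma geopt_simps:
  assumes "b \<in> mspace Y" "p \<in> mspace Y" "t \<in> {0..1}"
  shows "geopt Y b t p \<in> mspace Y"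
    "mdist Y b (geopt Y b t p) = t * mdist Y b p"
    "mdist Y p (geopt Y b t p) = (1 - t) * mdist Y b p"
  using geopt_geodesic[OF assms(1,2)] geodesic_from_to_dist[OF _ assms(3)] by metis+

text \<open>
  The comparison axiom in terms of fractions of sides, so that comparison points become
  explicit vectors.
\<close>

lemma CAT0_two_geodesics:
  assumes "geodesic_from_to Y b p \<gamma>" "geodesic_from_to Y b q \<delta>"
    and "b \<in> mspace Y" "p \<in> mspace Y" "q \<in> mspace Y" "s \<in> {0..1}" "t \<in> {0..1}"
  obtains x y z :: "real^2" where "dist x y = mdist Y b p" "dist y z = mdist Y p q" "dist x z = mdist Y b q"
    "mdist Y (\<gamma> (s * mdist Y b p)) (\<delta> (t * mdist Y b q)) \<le> dist (x + s *\<^sub>R (y - x)) (x + t *\<^sub>R (z - x))"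
proof -
  note [simp] = mdist_nonneg_of
  have "mdist Y b p \<le> mdist Y p q + mdist Y b q" "mdist Y p q \<le> mdist Y b p + mdist Y b q" "mdist Y b q \<le> mdist Y b p + mdist Y p q"
    using assms mdist_triangle_of[of b Y p q] mdist_triangle_of[of b Y q p] mdist_triangle_of[of p Y b q]
    by (auto simp: mdist_commute_of[of Y q p] mdist_commute_of[of Y p b])
  then obtain x y z :: "real^2" where
    xyz: "dist x y = mdist Y b p" "dist y z = mdist Y p q" "dist x z = mdist Y b q"
    by (metis comparison_triangle mdist_nonneg_of)
  have seg: "x + s *\<^sub>R (y - x) \<in> closed_segment x y" "x + t *\<^sub>R (z - x) \<in> closed_segment x z"
    using assms by (auto simp: in_segment algebra_simps)
  have ds: "dist x (x + s *\<^sub>R (y - x)) = s * mdist Y b p" "dist x (x + t *\<^sub>R (z - x)) = t * mdist Y b q"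
    using assms xyz by (auto simp: dist_norm norm_minus_commute)
  have "s * mdist Y b p \<in> {0..mdist Y b p}" "t * mdist Y b q \<in> {0..mdist Y b q}"
    using assms by (auto intro: mult_left_le_one_le)
  then have "mdist Y (\<gamma> (s * mdist Y b p)) (\<delta> (t * mdist Y b q)) \<le> dist (x + s *\<^sub>R (y - x)) (x + t *\<^sub>R (z - x))"
    using C xyz seg ds assms unfolding CAT0_def by blast
  with xyz show thesis by (rule that)
qed

text \<open>
  Triangles are at least as thin as their Euclidean comparison triangles, in which a homothety with
  ratio \<open>t\<close> scales the side opposite to the centre by exactly \<open>t\<close>.
\<close>

lemma geopt_contract:
  assumes "b \<in> mspace Y" "p \<in> mspace Y" "q \<in> mspace Y" "t \<in> {0..1}"
  shows "mdist Y (geopt Y b t p) (geopt Y b t q) \<le> t * mdist Y p q"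
proof -
  obtain \<gamma> where g: "geodesic_from_to Y b p \<gamma>" "geopt Y b t p = \<gamma> (t * mdist Y b p)"
    using geopt_geodesic[OF assms(1,2)] by metis
  obtain \<delta> where d: "geodesic_from_to Y b q \<delta>" "geopt Y b t q = \<delta> (t * mdist Y b q)"
    using geopt_geodesic[OF assms(1,3)] by metis
  obtain x y z :: "real^2" where xyz: "dist y z = mdist Y p q"
    "mdist Y (\<gamma> (t * mdist Y b p)) (\<delta> (t * mdist Y b q)) \<le> dist (x + t *\<^sub>R (y - x)) (x + t *\<^sub>R (z - x))"
    using CAT0_two_geodesics[OF g(1) d(1) assms(1-3) assms(4,4)] by metis
  have "dist (x + t *\<^sub>R (y - x)) (x + t *\<^sub>R (z - x)) = norm (t *\<^sub>R (y - z))"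
    by (simp add: dist_norm algebra_simps)
  also have "\<dots> = t * dist y z" using assms by (simp add: dist_norm)
  finally show ?thesis using xyz g d by simp
qed

text \<open>
  In the comparison triangle this is Stewart's identity for the length of a cevian.  It says that
  squared distance functions are uniformly convex along geodesics.
\<close>

lemma geopt_Stewart:
  assumes "b \<in> mspace Y" "p \<in> mspace Y" "z \<in> mspace Y" "t \<in> {0..1}"
  shows "(mdist Y z (geopt Y b t p))\<^sup>2 \<le>
     (1 - t) * (mdist Y z b)\<^sup>2 + t * (mdist Y z p)\<^sup>2 - t * (1 - t) * (mdist Y b p)\<^sup>2"
proof -
  obtain \<gamma> where g: "geodesic_from_to Y b p \<gamma>" "geopt Y b t p = \<gamma> (t * mdist Y b p)"
    using geopt_geodesic[OF assms(1,2)] by metis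
  obtain \<delta> where d: "geodesic_from_to Y b z \<delta>"
    using geopt_geodesic[OF assms(1,3)] by metis
  obtain x y w :: "real^2" where xyz: "dist x y = mdist Y b p" "dist y w = mdist Y p z" "dist x w = mdist Y b z"
    "mdist Y (\<gamma> (t * mdist Y b p)) (\<delta> (1 * mdist Y b z)) \<le> dist (x + t *\<^sub>R (y - x)) (x + 1 *\<^sub>R (w - x))"
    using CAT0_two_geodesics[OF g(1) d(1) assms(1-4), of 1] by auto
  have "\<delta> (mdist Y b z) = z" using d by (simp add: geodesic_from_to_def)
  then have "mdist Y z (geopt Y b t p) \<le> norm (t *\<^sub>R (y - x) - (w - x))"
    using xyz(4) g by (simp add: mdist_commute_of[of Y z] dist_norm algebra_simps)
  then have "(mdist Y z (geopt Y b t p))\<^sup>2 \<le> (norm (t *\<^sub>R (y - x) - (w - x)))\<^sup>2"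
    by (rule power_mono) (rule mdist_nonneg_of)
  also have "\<dots> = (1 - t) * (norm (x - w))\<^sup>2 + t * (norm (y - w))\<^sup>2 - t * (1 - t) * (norm (x - y))\<^sup>2"
    unfolding power2_norm_eq_inner
    by (simp add: inner_diff_left inner_diff_right inner_commute algebra_simps)
  finally show ?thesis
    using xyz by (simp add: dist_norm mdist_commute_of[of Y z])
qed

text \<open>
  For a point \<open>q\<close> that divides \<open>b\<close>, \<open>p\<close> in the right proportion, the right-hand side of Stewart's
  inequality vanishes.
\<close>

lemma geopt_unique:
  assumes "b \<in> mspace Y" "p \<in> mspace Y" "q \<in> mspace Y" "t \<in> {0..1}"
    and "mdist Y b q = t * mdist Y b p" "mdist Y q p = (1 - t) * mdist Y b p"
  shows "q = geopt Y b t p"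
proof -
  have "(mdist Y q (geopt Y b t p))\<^sup>2 \<le>
     (1 - t) * (mdist Y q b)\<^sup>2 + t * (mdist Y q p)\<^sup>2 - t * (1 - t) * (mdist Y b p)\<^sup>2"
    using assms by (intro geopt_Stewart) auto
  also have "\<dots> = 0"
    unfolding mdist_commute_of[of Y q b] assms(5,6) by (simp add: power2_eq_square algebra_simps)
  finally have "mdist Y q (geopt Y b t p) = 0" by simp
  then show ?thesis
    using assms geopt_simps(1)[of b p t] by (simp add: Metric_space.zero[OF Metric_space_mspace_mdist])
qed

end

text \<open>
  A 1-Lipschitz path between two points whose duration is their distance cannot lose anything in
  the triangle inequality, so it is a geodesic.
\<close>

lemma geodesic_on_lipschitz:
  assumes "x \<in> mspace Y" "y \<in> mspace Y" "c 0 = x" "c (mdist Y x y) = y"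
    and c: "c \<in> {0..mdist Y x y} \<rightarrow> mspace Y"
    and lip: "\<And>s t. s \<in> {0..mdist Y x y} \<Longrightarrow> t \<in> {0..mdist Y x y} \<Longrightarrow> mdist Y (c s) (c t) \<le> \<bar>s - t\<bar>"
  shows "geodesic_from_to Y x y c"
proof -
  let ?D = "mdist Y x y"
  have D: "0 \<le> ?D" by (rule mdist_nonneg_of)
  have le: "mdist Y (c s) (c t) = \<bar>s - t\<bar>" if "s \<in> {0..?D}" "t \<in> {0..?D}" "s \<le> t" for s t
  proof -
    have mem: "c s \<in> mspace Y" "c t \<in> mspace Y" using c that by auto
    have "?D \<le> mdist Y (c 0) (c s) + mdist Y (c s) (c ?D)"
      using mdist_triangle_of[of x Y y "c s"] mem assms(1-4) by (auto simp: mdist_triangle_of)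
    also have "mdist Y (c s) (c ?D) \<le> mdist Y (c s) (c t) + mdist Y (c t) (c ?D)"
      using mem assms(1-4) by (auto simp: mdist_triangle_of)
    finally show ?thesis
      using lip[of 0 s] lip[of t ?D] lip[of s t] that D by auto
  qed
  have "mdist Y (c s) (c t) = \<bar>s - t\<bar>" if "s \<in> {0..?D}" "t \<in> {0..?D}" for s t
    using le[of s t] le[of t s] that mdist_commute_of[of Y "c s" "c t"] by (cases "s \<le> t") auto
  then show ?thesis
    using assms(3,4) c by (auto simp: geodesic_from_to_def geodesic_on_def is_interval_cc)
qed

text \<open>
  The retraction brings back to \<open>Y\<close> what \<open>X\<close> provides: a geodesic of \<open>X\<close> between two points of \<open>Y\<close>
  becomes a 1-Lipschitz path of the right duration, hence a geodesic of \<open>Y\<close>, and the limit in \<open>X\<close> of a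
  Cauchy sequence in \<open>Y\<close> becomes a limit in \<open>Y\<close>.  The comparison inequality is inherited by every
  isometrically embedded subspace.
\<close>

lemma
  assumes j: "j \<in> mspace Y \<rightarrow> mspace X" "\<And>x y. x \<in> mspace Y \<Longrightarrow> y \<in> mspace Y \<Longrightarrow> mdist X (j x) (j y) = mdist Y x y"
    and \<pi>: "\<pi> \<in> mspace X \<rightarrow> mspace Y" "\<And>x y. x \<in> mspace X \<Longrightarrow> y \<in> mspace X \<Longrightarrow> mdist Y (\<pi> x) (\<pi> y) \<le> mdist X x y"
    and \<pi>j: "\<And>x. x \<in> mspace Y \<Longrightarrow> \<pi> (j x) = x"
  shows CAT0_retract: "CAT0 X \<Longrightarrow> CAT0 Y"
    and mcomplete_retract: "mcomplete_of X \<Longrightarrow> mcomplete_of Y"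
proof -
  assume X: "CAT0 X"
  have geo: "geodesic_from_to X (j x) (j y) (j \<circ> \<gamma>)"
    if "geodesic_from_to Y x y \<gamma>" "x \<in> mspace Y" "y \<in> mspace Y" for x y \<gamma>
    using that j unfolding geodesic_from_to_def geodesic_on_def by (auto simp: Pi_iff)
  show "CAT0 Y"
    unfolding CAT0_def
  proof (intro conjI ballI allI impI)
    fix x y assume xy: "x \<in> mspace Y" "y \<in> mspace Y"
    then obtain \<gamma> where \<gamma>: "geodesic_from_to X (j x) (j y) \<gamma>"
      using X j unfolding CAT0_def by blast
    have D: "mdist X (j x) (j y) = mdist Y x y" using xy j by auto
    have "geodesic_from_to Y x y (\<pi> \<circ> \<gamma>)"
    proof (rule geodesic_on_lipschitz)
      show "(\<pi> \<circ> \<gamma>) 0 = x" "(\<pi> \<circ> \<gamma>) (mdist Y x y) = y"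
        using \<gamma> \<pi>j xy D by (auto simp: geodesic_from_to_def)
      show "\<pi> \<circ> \<gamma> \<in> {0..mdist Y x y} \<rightarrow> mspace Y"
        using \<gamma> \<pi> D by (auto simp: geodesic_from_to_def geodesic_on_def Pi_iff)
      fix s t assume st: "s \<in> {0..mdist Y x y}" "t \<in> {0..mdist Y x y}"
      then have "\<gamma> s \<in> mspace X" "\<gamma> t \<in> mspace X" "mdist X (\<gamma> s) (\<gamma> t) = \<bar>s - t\<bar>"
        using \<gamma> D by (auto simp: geodesic_from_to_def geodesic_on_def Pi_iff)
      then show "mdist Y ((\<pi> \<circ> \<gamma>) s) ((\<pi> \<circ> \<gamma>) t) \<le> \<bar>s - t\<bar>"
        using \<pi>(2)[of "\<gamma> s" "\<gamma> t"] by simp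
    qed (use xy in auto)
    then show "\<exists>\<gamma>. geodesic_from_to Y x y \<gamma>" by blast
  next
    fix x y z \<gamma> \<delta> s t and x' y' z' p' q' :: "real^2"
    assume A: "x \<in> mspace Y" "y \<in> mspace Y" "z \<in> mspace Y"
      "geodesic_from_to Y x y \<gamma>" "geodesic_from_to Y x z \<delta>"
      "dist x' y' = mdist Y x y" "dist y' z' = mdist Y y z" "dist x' z' = mdist Y x z"
      "s \<in> {0..mdist Y x y}" "t \<in> {0..mdist Y x z}"
      "p' \<in> closed_segment x' y'" "q' \<in> closed_segment x' z'" "dist x' p' = s" "dist x' q' = t"
    have mem: "j x \<in> mspace X" "j y \<in> mspace X" "j z \<in> mspace X" using A j by auto
    have gm: "\<gamma> s \<in> mspace Y" "\<delta> t \<in> mspace Y"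
      using A by (auto simp: geodesic_from_to_def geodesic_on_def Pi_iff)
    have "mdist X ((j \<circ> \<gamma>) s) ((j \<circ> \<delta>) t) \<le> dist p' q'"
      using X mem geo[OF A(4,1,2)] geo[OF A(5,1,3)] A(6-14) j(2) A(1-3) unfolding CAT0_def by metis
    then show "mdist Y (\<gamma> s) (\<delta> t) \<le> dist p' q'" using gm j by simp
  qed
next
  assume X: "mcomplete_of X"
  interpret X: Metric_space "mspace X" "mdist X" by (rule Metric_space_mspace_mdist)
  interpret Y: Metric_space "mspace Y" "mdist Y" by (rule Metric_space_mspace_mdist)
  show "mcomplete_of Y"
    unfolding mcomplete_of_def Y.mcomplete_def
  proof (intro allI impI)
    fix \<sigma> assume s: "Y.MCauchy \<sigma>"
    then have r: "\<sigma> n \<in> mspace Y" for n by (auto simp: Y.MCauchy_def)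
    have "X.MCauchy (j \<circ> \<sigma>)"
      using s j r by (auto simp: Y.MCauchy_def X.MCauchy_def Pi_iff)
    then obtain x where x: "limitin X.mtopology (j \<circ> \<sigma>) x sequentially"
      using X by (auto simp: mcomplete_of_def X.mcomplete_def)
    have "limitin Y.mtopology \<sigma> (\<pi> x) sequentially"
      unfolding Y.limit_metric_sequentially
    proof (intro conjI allI impI)
      show "\<pi> x \<in> mspace Y" using x \<pi> by (auto simp: X.limit_metric_sequentially)
      fix e :: real assume "0 < e"
      then obtain N where N: "\<And>n. n \<ge> N \<Longrightarrow> mdist X (j (\<sigma> n)) x < e"
        using x unfolding X.limit_metric_sequentially comp_def by meson
      have "mdist Y (\<sigma> n) (\<pi> x) < e" if "n \<ge> N" for n
      proof -
        have "mdist Y (\<pi> (j (\<sigma> n))) (\<pi> x) \<le> mdist X (j (\<sigma> n)) x"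
          using \<pi> j r x by (auto simp: X.limit_metric_sequentially Pi_iff)
        then show ?thesis using \<pi>j[OF r] N[OF that] by simp
      qed
      then show "\<exists>N. \<forall>n\<ge>N. \<sigma> n \<in> mspace Y \<and> mdist Y (\<sigma> n) (\<pi> x) < e"
        using r by blast
    qed
    then show "\<exists>x. limitin Y.mtopology \<sigma> x sequentially" by blast
  qed
qed

lemma limitin_mdist_tendsto:
  assumes "limitin (mtopology_of Y) \<sigma> x sequentially" "range \<sigma> \<subseteq> mspace Y" "y \<in> mspace Y"
  shows "(\<lambda>n. mdist Y y (\<sigma> n)) \<longlonglongrightarrow> mdist Y y x"
proof -
  interpret Y: Metric_space "mspace Y" "mdist Y" by (rule Metric_space_mspace_mdist)
  have l: "limitin Y.mtopology \<sigma> x sequentially" using assms by (simp add: mtopology_of_def)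
  then have x: "x \<in> mspace Y" by (auto simp: Y.limit_metric_sequentially)
  have lim0: "(\<lambda>n. mdist Y (\<sigma> n) x) \<longlonglongrightarrow> 0"
    using l unfolding Y.limit_metric_sequentially LIMSEQ_iff by (simp; meson)
  show ?thesis
  proof (rule Lim_transform_bound[OF _ lim0, THEN LIM_zero_cancel])
    have "\<bar>mdist Y y (\<sigma> n) - mdist Y y x\<bar> \<le> mdist Y (\<sigma> n) x" for n
      using Y.triangle[of y "\<sigma> n" x] Y.triangle[of y x "\<sigma> n"] assms x
      by (auto simp: Y.commute[of x] image_subset_iff)
    then show "\<forall>\<^sub>F n in sequentially. norm (mdist Y y (\<sigma> n) - mdist Y y x) \<le> norm (mdist Y (\<sigma> n) x)"
      by simp
  qed
qed

text \<open>
  Existence of the barycentre of a weighted finite family of points.  By uniform convexity, two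
  almost minimizers of the sum of squared distances are close to each other: otherwise their
  midpoint would do better than the infimum.  Hence minimizing sequences are Cauchy.
\<close>

lemma CAT0_minimizer:
  fixes w :: "'v \<Rightarrow> real"
  assumes C: "CAT0 Y" and comp: "mcomplete_of Y"
    and w: "\<And>v. v \<in> V \<Longrightarrow> 0 \<le> w v" "sum w V = 1" and f: "f \<in> V \<rightarrow> mspace Y"
  obtains b where "b \<in> mspace Y"
    "\<And>z. z \<in> mspace Y \<Longrightarrow> (\<Sum>v\<in>V. w v * (mdist Y b (f v))\<^sup>2) \<le> (\<Sum>v\<in>V. w v * (mdist Y z (f v))\<^sup>2)"
proof -
  interpret Y: Metric_space "mspace Y" "mdist Y" by (rule Metric_space_mspace_mdist)
  define Q where "Q y = (\<Sum>v\<in>V. w v * (mdist Y y (f v))\<^sup>2)" for y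
  have Q0: "0 \<le> Q y" for y unfolding Q_def using w by (intro sum_nonneg) auto
  have ne: "mspace Y \<noteq> {}" using f w(2) by (cases "V = {}") auto
  define I where "I = Inf (Q ` mspace Y)"
  have bdd: "bdd_below (Q ` mspace Y)" by (rule bdd_belowI2) (rule Q0)
  have I: "I \<le> Q y" if "y \<in> mspace Y" for y
    unfolding I_def using that bdd by (intro cInf_lower) auto
  have "\<exists>y\<in>mspace Y. Q y < I + 1 / (real n + 1)" for n
  proof -
    have "Inf (Q ` mspace Y) < I + 1 / (real n + 1)" by (simp add: I_def)
    then show ?thesis using ne bdd by (subst (asm) cInf_less_iff) auto
  qed
  then obtain y where y: "\<And>n. y n \<in> mspace Y" "\<And>n. Q (y n) < I + 1 / (real n + 1)" by metis
  have par: "(mdist Y a c)\<^sup>2 \<le> 2 * Q a + 2 * Q c - 4 * I" if ac: "a \<in> mspace Y" "c \<in> mspace Y" for a c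
  proof -
    let ?m = "geopt Y a (1/2) c"
    have m: "?m \<in> mspace Y" using geopt_simps(1)[OF C ac, of "1/2"] by simp
    \<comment> \<open>The sum of the midpoint inequalities, applied from each of the points \<open>f v\<close>.\<close>
    have "Q ?m \<le> (\<Sum>v\<in>V. w v * (1/2 * (mdist Y a (f v))\<^sup>2 + 1/2 * (mdist Y c (f v))\<^sup>2 - 1/4 * (mdist Y a c)\<^sup>2))"
      unfolding Q_def
    proof (intro sum_mono mult_left_mono w)
      fix v assume "v \<in> V"
      then show "(mdist Y ?m (f v))\<^sup>2 \<le> 1/2 * (mdist Y a (f v))\<^sup>2 + 1/2 * (mdist Y c (f v))\<^sup>2 - 1/4 * (mdist Y a c)\<^sup>2"
        using geopt_Stewart[OF C ac, of "f v" "1/2"] f by (auto simp: Y.commute[of "f v"])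
    qed
    also have "\<dots> = 1/2 * Q a + 1/2 * Q c - 1/4 * (mdist Y a c)\<^sup>2 * sum w V"
      unfolding Q_def sum_distrib_left sum.distrib[symmetric] sum_subtractf[symmetric]
      by (intro sum.cong) (auto simp: algebra_simps)
    finally show ?thesis using I[OF m] w by simp
  qed
  have "Y.MCauchy y"
    unfolding Y.MCauchy_def
  proof (intro conjI allI impI)
    show "range y \<subseteq> mspace Y" using y by auto
    fix e :: real assume e: "0 < e"
    then obtain N :: nat where N: "4 / e\<^sup>2 < real N" using reals_Archimedean2 by blast
    have "mdist Y (y n) (y n') < e" if "N \<le> n" "N \<le> n'" for n n'
    proof -
      have "(mdist Y (y n) (y n'))\<^sup>2 \<le> 2 * (1 / (real n + 1)) + 2 * (1 / (real n' + 1))"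
        using par[OF y(1) y(1), of n n'] y(2)[of n] y(2)[of n'] by simp
      also have "\<dots> \<le> 2 * (1 / (real N + 1)) + 2 * (1 / (real N + 1))"
        using that by (intro add_mono mult_left_mono divide_left_mono) auto
      also have "\<dots> = 4 / (real N + 1)" by simp
      also have "\<dots> < e\<^sup>2"
      proof -
        have "4 < e\<^sup>2 * real N" using N e by (simp add: divide_less_eq mult.commute)
        also have "\<dots> \<le> e\<^sup>2 * (real N + 1)" by (intro mult_left_mono) auto
        finally show ?thesis by (simp add: divide_less_eq)
      qed
      finally show ?thesis using e by (simp add: power_less_imp_less_base)
    qed
    then show "\<exists>N. \<forall>n n'. N \<le> n \<longrightarrow> N \<le> n' \<longrightarrow> mdist Y (y n) (y n') < e" by blast
  qed
  then obtain b where b: "limitin Y.mtopology y b sequentially"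
    using comp by (auto simp: mcomplete_of_def Y.mcomplete_def)
  have bY: "b \<in> mspace Y" using b by (auto simp: Y.limit_metric_sequentially)
  have "(\<lambda>n. mdist Y (y n) (f v)) \<longlonglongrightarrow> mdist Y b (f v)" if "v \<in> V" for v
    using limitin_mdist_tendsto[of Y y b "f v"] b y(1) funcset_mem[OF f that]
    by (auto simp: mtopology_of_def Y.commute[of "f v"])
  then have lQ: "(\<lambda>n. Q (y n)) \<longlonglongrightarrow> Q b" unfolding Q_def by (intro tendsto_intros)
  have "(\<lambda>n. I + 1 / (real n + 1)) \<longlonglongrightarrow> I + 0"
    using LIMSEQ_inverse_real_of_nat by (intro tendsto_intros) (simp add: field_simps)
  then have "Q b \<le> I + 0"
    using lQ y(2) by (intro LIMSEQ_le[OF lQ]) (auto intro: less_imp_le)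
  then show thesis using that[of b] bY I unfolding Q_def by force
qed

section \<open>Poincare inequalities for maps into CAT(0) spaces\<close>

text \<open>
  The set \<open>A\<close> consists of ordered pairs, so that an edge of a graph will contribute twice.
  Averaging over pairs instead of subtracting a mean gives the inequality a meaning in every
  metric space.
\<close>

definition poincare_inequality :: "'v set \<Rightarrow> ('v \<Rightarrow> real) \<Rightarrow> ('v \<times> 'v) set \<Rightarrow> real \<Rightarrow> 'a metric \<Rightarrow> bool" where
  "poincare_inequality V w A \<Lambda> Y \<longleftrightarrow>
     (\<forall>f \<in> V \<rightarrow> mspace Y. (\<Sum>u\<in>V. \<Sum>v\<in>V. w u * w v * (mdist Y (f u) (f v))\<^sup>2)
        \<le> \<Lambda> * (\<Sum>(u, v)\<in>A. (mdist Y (f u) (f v))\<^sup>2))"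

text \<open>
  A bound on the complexity of the infinitesimal geometry: only the number \<open>M\<close> is uniform, whereas
  the scale \<open>s0\<close> below which it is valid may depend on the point.
\<close>

definition small_scale_covering :: "'a metric \<Rightarrow> nat \<Rightarrow> bool" where
  "small_scale_covering Y M \<longleftrightarrow>
     (\<forall>b \<in> mspace Y. \<exists>s0 > 0. \<forall>s. 0 < s \<and> s < s0 \<longrightarrow>
        (\<exists>C \<subseteq> mspace Y. finite C \<and> card C \<le> M \<and> mcball_of Y b s \<subseteq> (\<Union>c \<in> C. mcball_of Y c (s / 4))))"

lemma cover_pigeonhole:
  fixes w :: "'v \<Rightarrow> real"
  assumes "finite B" "finite C" "card C \<le> M" "\<And>v. v \<in> B \<Longrightarrow> 0 \<le> w v" "B \<subseteq> (\<Union>c\<in>C. P c)" "0 < a" "a \<le> sum w B"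
  obtains c where "c \<in> C" "a / real M \<le> sum w (B \<inter> P c)"
proof -
  have "\<exists>c\<in>C. a / real M \<le> sum w (B \<inter> P c)"
  proof (rule ccontr)
    assume *: "\<not> ?thesis"
    have "C \<noteq> {}" using assms by auto
    have "sum w B \<le> (\<Sum>v\<in>B. \<Sum>c\<in>C. if v \<in> P c then w v else 0)"
    proof (rule sum_mono)
      fix v assume v: "v \<in> B"
      then obtain c where c: "c \<in> C" "v \<in> P c" using assms by auto
      have "(if v \<in> P c then w v else 0) \<le> (\<Sum>c\<in>C. if v \<in> P c then w v else 0)"
        using c assms v by (intro member_le_sum) auto
      then show "w v \<le> (\<Sum>c\<in>C. if v \<in> P c then w v else 0)" using c by simp
    qed
    also have "\<dots> = (\<Sum>c\<in>C. sum w (B \<inter> P c))"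
      using assms by (subst sum.swap) (simp add: sum.inter_restrict)
    also have "\<dots> < (\<Sum>c\<in>C. a / real M)"
      using * \<open>C \<noteq> {}\<close> assms by (intro sum_strict_mono) auto
    also have "\<dots> = real (card C) / real M * a" by simp
    also have "\<dots> \<le> 1 * a" using assms by (intro mult_right_mono) (auto simp: divide_le_eq_1)
    finally show False using assms by simp
  qed
  then show thesis using that by blast
qed

lemma sum_product_split:
  fixes w :: "'v \<Rightarrow> real"
  assumes "sum w V = 1"
  shows "(\<Sum>u\<in>V. \<Sum>v\<in>V. w u * w v * (2 * r u + 2 * r v)) = 4 * (\<Sum>v\<in>V. w v * r v)"
proof -
  have "(\<Sum>u\<in>V. \<Sum>v\<in>V. w u * w v * (2 * r u + 2 * r v)) =
     (\<Sum>u\<in>V. \<Sum>v\<in>V. w v * (2 * (w u * r u)) + w u * (2 * (w v * r v)))"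
    by (simp add: algebra_simps)
  also have "\<dots> = (\<Sum>u\<in>V. sum w V * (2 * (w u * r u)) + w u * (\<Sum>v\<in>V. 2 * (w v * r v)))"
    unfolding sum.distrib sum_distrib_left sum_distrib_right by simp
  also have "\<dots> = 4 * (\<Sum>v\<in>V. w v * r v)"
    using assms by (simp add: sum.distrib sum_distrib_left[symmetric] sum_distrib_right[symmetric])
  finally show ?thesis .
qed

lemma square_sum_le: "((a::real) + b)\<^sup>2 \<le> 2 * a\<^sup>2 + 2 * b\<^sup>2"
  using zero_le_power2[of "a - b"] by (simp add: power2_eq_square algebra_simps)

text \<open>
  A function that is small on a set of weight at least \<open>\<theta>\<close> is small in mean square, up to its
  variance over pairs: each value is compared with the values on that set.
\<close>

lemma concentration_bound:
  fixes w H :: "'v \<Rightarrow> real"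
  assumes V: "finite V" and w: "\<And>v. v \<in> V \<Longrightarrow> 0 \<le> w v" "sum w V = 1"
    and B: "B \<subseteq> V" "\<And>u. u \<in> B \<Longrightarrow> (H u)\<^sup>2 \<le> K" and \<theta>: "0 < \<theta>" "\<theta> \<le> sum w B"
  shows "\<theta> * ((\<Sum>v\<in>V. w v * (H v)\<^sup>2) - 2 * K) \<le> 2 * (\<Sum>u\<in>V. \<Sum>v\<in>V. w u * w v * (H u - H v)\<^sup>2)"
proof -
  let ?T = "\<Sum>v\<in>V. w v * (H v)\<^sup>2" and ?P = "\<Sum>u\<in>V. \<Sum>v\<in>V. w u * w v * (H u - H v)\<^sup>2"
  have P0: "0 \<le> ?P" using w by (intro sum_nonneg mult_nonneg_nonneg) auto
  have "sum w B * (?T - 2 * K) = (\<Sum>u\<in>B. w u * (?T - 2 * K))" by (simp add: sum_distrib_right)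
  also have "\<dots> \<le> (\<Sum>u\<in>B. w u * (\<Sum>v\<in>V. w v * (2 * (H u - H v)\<^sup>2)))"
  proof (intro sum_mono mult_left_mono)
    fix u assume u: "u \<in> B"
    have "?T \<le> (\<Sum>v\<in>V. w v * (2 * K + 2 * (H u - H v)\<^sup>2))"
    proof (intro sum_mono mult_left_mono w)
      fix v
      show "(H v)\<^sup>2 \<le> 2 * K + 2 * (H u - H v)\<^sup>2"
        using square_sum_le[of "H u" "H v - H u"] B(2)[OF u] by (simp add: power2_commute[of "H v"])
    qed
    also have "\<dots> = 2 * K * sum w V + (\<Sum>v\<in>V. w v * (2 * (H u - H v)\<^sup>2))"
      by (simp add: distrib_left sum.distrib sum_distrib_right[symmetric] mult.commute)
    finally show "?T - 2 * K \<le> (\<Sum>v\<in>V. w v * (2 * (H u - H v)\<^sup>2))" using w by simp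
  qed (use w B in auto)
  also have "\<dots> \<le> (\<Sum>u\<in>V. w u * (\<Sum>v\<in>V. w v * (2 * (H u - H v)\<^sup>2)))"
    using V B w by (intro sum_mono2) (auto intro!: sum_nonneg mult_nonneg_nonneg)
  also have "\<dots> = 2 * ?P" by (simp add: sum_distrib_left algebra_simps)
  finally have le: "sum w B * (?T - 2 * K) \<le> 2 * ?P" .
  show ?thesis
  proof (cases "0 \<le> ?T - 2 * K")
    case True
    then show ?thesis using le \<theta> mult_right_mono[of \<theta> "sum w B" "?T - 2 * K"] by linarith
  next
    case False
    then show ?thesis using P0 \<theta> mult_pos_neg[of \<theta> "?T - 2 * K"] by linarith
  qed
qed

lemma chebyshev_weighted:
  fixes w r :: "'v \<Rightarrow> real"
  assumes V: "finite V" and w: "\<And>v. v \<in> V \<Longrightarrow> 0 \<le> w v" "sum w V = 1"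
    and S: "(\<Sum>v\<in>V. w v * (r v)\<^sup>2) = \<rho>\<^sup>2" "0 < \<rho>"
  shows "3/4 \<le> sum w {v \<in> V. r v \<le> 2 * \<rho>}"
proof -
  let ?B = "{v \<in> V. r v \<le> 2 * \<rho>}"
  have "sum w (V - ?B) * (4 * \<rho>\<^sup>2) = (\<Sum>v\<in>V - ?B. w v * (2 * \<rho>)\<^sup>2)" by (simp add: sum_distrib_right)
  also have "\<dots> \<le> (\<Sum>v\<in>V - ?B. w v * (r v)\<^sup>2)"
    using w S by (intro sum_mono mult_left_mono power_mono) auto
  also have "\<dots> \<le> (\<Sum>v\<in>V. w v * (r v)\<^sup>2)"
    using w V by (intro sum_mono2) auto
  finally have "sum w (V - ?B) \<le> 1/4" using S by simp
  moreover have "sum w V = sum w (V - ?B) + sum w ?B" using V by (intro sum.subset_diff) auto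
  ultimately show ?thesis using w by simp
qed

text \<open>
  Let \<open>b\<close> be the barycentre of the values of \<open>f\<close> and \<open>r v\<close> the distance from \<open>b\<close>
  to \<open>f v\<close>.  The mean square \<open>S\<close> of \<open>r\<close> is to be bounded by the energy \<open>E\<close> of \<open>f\<close>.
  
  Pull all points towards \<open>b\<close> by a homothety with a tiny ratio \<open>\<epsilon>\<close>, which brings them to the scale
  where the covering condition applies.  By pigeonhole, a ball around some point \<open>z\<close>, of radius
  \<open>\<epsilon> / 2\<close> times the root mean square of \<open>r\<close>, captures a definite proportion of the weight.  The
  real-valued function \<open>H\<close>, the distance from \<open>z\<close> to the contracted points divided by \<open>\<epsilon>\<close>, has
  energy at most \<open>E\<close>.  If \<open>E\<close> were small compared with \<open>S\<close>, then \<open>H\<close> would be almost constant, hence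
  mostly of size about half the root mean square of \<open>r\<close> or less; so nearly all contracted points
  would lie on one side of \<open>b\<close>, namely near \<open>z\<close>, and \<open>z\<close> would be a better centre than \<open>b\<close>.
  Points that are close to each other after the contraction may have been far apart before it, so \<open>H\<close>
  has to be measured at the small scale.
\<close>

theorem CAT0_poincare:
  fixes w :: "'v \<Rightarrow> real"
  assumes C: "CAT0 Y" and comp: "mcomplete_of Y" and cov: "small_scale_covering Y M"
    and V: "finite V" and w: "\<And>v. v \<in> V \<Longrightarrow> 0 \<le> w v" "sum w V = 1" and A: "A \<subseteq> V \<times> V" and \<Lambda>: "0 \<le> \<Lambda>"
    and P: "poincare_inequality V w A \<Lambda> (euclidean_metric :: real metric)"
  shows "poincare_inequality V w A (64 / 3 * real M * \<Lambda>) Y"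
  unfolding poincare_inequality_def
proof
  fix f assume f: "f \<in> V \<rightarrow> mspace Y"
  let ?E = "\<Sum>(u, v)\<in>A. (mdist Y (f u) (f v))\<^sup>2"
  have E0: "0 \<le> ?E" by (intro sum_nonneg) auto
  obtain b where b: "b \<in> mspace Y"
    "\<And>z. z \<in> mspace Y \<Longrightarrow> (\<Sum>v\<in>V. w v * (mdist Y b (f v))\<^sup>2) \<le> (\<Sum>v\<in>V. w v * (mdist Y z (f v))\<^sup>2)"
    using CAT0_minimizer[OF C comp w f] by metis
  define r where "r v = mdist Y b (f v)" for v
  define S where "S = (\<Sum>v\<in>V. w v * (r v)\<^sup>2)"
  have S0: "0 \<le> S" unfolding S_def using w by (intro sum_nonneg) auto
  have "(\<Sum>u\<in>V. \<Sum>v\<in>V. w u * w v * (mdist Y (f u) (f v))\<^sup>2)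
       \<le> (\<Sum>u\<in>V. \<Sum>v\<in>V. w u * w v * (2 * (r u)\<^sup>2 + 2 * (r v)\<^sup>2))"
  proof (intro sum_mono mult_left_mono)
    fix u v assume "u \<in> V" "v \<in> V"
    then have "mdist Y (f u) (f v) \<le> r u + r v"
      using mdist_triangle_of[of "f u" Y b "f v"] b(1) funcset_mem[OF f]
      by (auto simp: r_def mdist_commute_of[of Y "f u" b])
    then have "(mdist Y (f u) (f v))\<^sup>2 \<le> (r u + r v)\<^sup>2" by (intro power_mono mdist_nonneg_of)
    also have "\<dots> \<le> 2 * (r u)\<^sup>2 + 2 * (r v)\<^sup>2" by (rule square_sum_le)
    finally show "(mdist Y (f u) (f v))\<^sup>2 \<le> 2 * (r u)\<^sup>2 + 2 * (r v)\<^sup>2" .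
  qed (use w in auto)
  also have "\<dots> = 4 * S"
    unfolding S_def using sum_product_split[OF w(2), of "\<lambda>v. (r v)\<^sup>2"] by simp
  also have "S \<le> 16 / 3 * real M * \<Lambda> * ?E"
  proof (cases "S = 0")
    case True
    then show ?thesis using E0 \<Lambda> by simp
  next
    case False
    define \<rho> where "\<rho> = sqrt S"
    have \<rho>: "0 < \<rho>" "S = \<rho>\<^sup>2" using False S0 by (auto simp: \<rho>_def)
    obtain s0 where s0: "0 < s0" "\<And>s. 0 < s \<Longrightarrow> s < s0 \<Longrightarrow>
        \<exists>C \<subseteq> mspace Y. finite C \<and> card C \<le> M \<and> mcball_of Y b s \<subseteq> (\<Union>c \<in> C. mcball_of Y c (s / 4))"
      using cov b unfolding small_scale_covering_def by metis
    \<comment> \<open>The ratio is such that balls of radius \<open>2 * \<epsilon> * \<rho>\<close>, with the root mean square \<open>\<rho>\<close> of \<open>r\<close>, are small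
      enough for the covering condition.\<close>
    define \<epsilon> where "\<epsilon> = min 1 (s0 / (4 * \<rho>))"
    have \<epsilon>: "0 < \<epsilon>" "\<epsilon> \<le> 1" using s0 \<rho> by (auto simp: \<epsilon>_def)
    then have e01: "\<epsilon> \<in> {0..1}" by auto
    have "\<epsilon> \<le> s0 / (4 * \<rho>)" by (simp add: \<epsilon>_def)
    then have s: "0 < 2 * \<epsilon> * \<rho>" "2 * \<epsilon> * \<rho> < s0" using \<epsilon> \<rho> s0 by (auto simp: field_simps)
    obtain N where N: "N \<subseteq> mspace Y" "finite N" "card N \<le> M"
      "mcball_of Y b (2 * \<epsilon> * \<rho>) \<subseteq> (\<Union>c \<in> N. mcball_of Y c (2 * \<epsilon> * \<rho> / 4))"
      using s0(2)[OF s] by blast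
    define f' where "f' v = geopt Y b \<epsilon> (f v)" for v
    have fV: "f v \<in> mspace Y" if "v \<in> V" for v using f that by auto
    have f': "f' v \<in> mspace Y" "mdist Y b (f' v) = \<epsilon> * r v" "mdist Y (f v) (f' v) = (1 - \<epsilon>) * r v" if "v \<in> V" for v
      using geopt_simps[OF C b(1) fV[OF that] e01] by (auto simp: f'_def r_def)
    \<comment> \<open>By Chebyshev, at least three quarters of the weight lies within twice the root mean square.\<close>
    define B where "B = {v \<in> V. r v \<le> 2 * \<rho>}"
    have B: "3/4 \<le> sum w B" unfolding B_def
      using chebyshev_weighted[OF V w] \<rho> by (simp add: S_def)
    have "B \<subseteq> (\<Union>c\<in>N. {v. mdist Y c (f' v) \<le> \<epsilon> * \<rho> / 2})"
    proof
      fix v assume v: "v \<in> B"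
      then have "f' v \<in> mcball_of Y b (2 * \<epsilon> * \<rho>)" using f'[of v] b \<epsilon> by (auto simp: B_def)
      then show "v \<in> (\<Union>c\<in>N. {v. mdist Y c (f' v) \<le> \<epsilon> * \<rho> / 2})" using N by fastforce
    qed
    then obtain z where z: "z \<in> N" "(3/4) / real M \<le> sum w (B \<inter> {v. mdist Y z (f' v) \<le> \<epsilon> * \<rho> / 2})"
      using cover_pigeonhole[where P = "\<lambda>c. {v. mdist Y c (f' v) \<le> \<epsilon> * \<rho> / 2}" and B = B and C = N and a = "3/4"]
        V w N B by (smt (verit) B_def finite_subset mem_Collect_eq subsetI zero_less_divide_iff)
    have zY: "z \<in> mspace Y" using z N by auto
    have M: "0 < real M" using z(1) N by (auto simp: card_gt_0_iff intro: Nat.gr0I)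
    define H where "H v = mdist Y z (f' v) / \<epsilon>" for v
    let ?T = "\<Sum>v\<in>V. w v * (H v)\<^sup>2"
    have conc: "(3/4) / real M * (?T - 2 * (\<rho>\<^sup>2 / 4)) \<le> 2 * (\<Sum>u\<in>V. \<Sum>v\<in>V. w u * w v * (H u - H v)\<^sup>2)"
    proof (rule concentration_bound[OF V w _ _ _ z(2)])
      fix u assume "u \<in> B \<inter> {v. mdist Y z (f' v) \<le> \<epsilon> * \<rho> / 2}"
      then have "H u \<le> \<rho> / 2" using \<epsilon> by (simp add: H_def field_simps)
      then have "(H u)\<^sup>2 \<le> (\<rho> / 2)\<^sup>2" using \<epsilon> by (intro power_mono) (auto simp: H_def mdist_nonneg_of)
      then show "(H u)\<^sup>2 \<le> \<rho>\<^sup>2 / 4" by (simp add: power_divide)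
    qed (use M in \<open>auto simp: B_def\<close>)
    have "(\<Sum>u\<in>V. \<Sum>v\<in>V. w u * w v * (H u - H v)\<^sup>2) \<le> \<Lambda> * (\<Sum>(u, v)\<in>A. (H u - H v)\<^sup>2)"
      using P[unfolded poincare_inequality_def, rule_format, of H] by (simp add: dist_real_def)
    also have "\<dots> \<le> \<Lambda> * ?E"
    proof (intro mult_left_mono sum_mono \<Lambda>, clarify)
      fix u v assume "(u, v) \<in> A"
      then have uv: "u \<in> V" "v \<in> V" using A by auto
      have "\<bar>mdist Y z (f' u) - mdist Y z (f' v)\<bar> \<le> mdist Y (f' u) (f' v)"
        using mdist_triangle_of[of z Y "f' u" "f' v"] mdist_triangle_of[of z Y "f' v" "f' u"] zY f' uv
        by (auto simp: mdist_commute_of[of Y "f' v"])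
      also have "\<dots> \<le> \<epsilon> * mdist Y (f u) (f v)"
        unfolding f'_def using fV uv b by (intro geopt_contract[OF C] e01) auto
      finally have "\<bar>H u - H v\<bar> \<le> mdist Y (f u) (f v)"
        using \<epsilon> by (simp add: H_def diff_divide_distrib[symmetric] field_simps)
      then show "(H u - H v)\<^sup>2 \<le> (mdist Y (f u) (f v))\<^sup>2"
        by (metis power2_abs power_mono abs_ge_zero)
    qed
    finally have PP: "(\<Sum>u\<in>V. \<Sum>v\<in>V. w u * w v * (H u - H v)\<^sup>2) \<le> \<Lambda> * ?E" .
    \<comment> \<open>Minimality of \<open>b\<close> forces \<open>H\<close> to be at least as large as \<open>r\<close> in mean square: a point \<open>f v\<close> is
      reached from \<open>z\<close> via its contracted image, and the square is convex.\<close>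
    have "S \<le> (\<Sum>v\<in>V. w v * (mdist Y z (f v))\<^sup>2)" using b(2)[OF zY] by (simp add: S_def r_def)
    also have "\<dots> \<le> (\<Sum>v\<in>V. w v * ((1 - \<epsilon>) * (r v)\<^sup>2 + \<epsilon> * (H v)\<^sup>2))"
    proof (intro sum_mono mult_left_mono w)
      fix v assume v: "v \<in> V"
      have "mdist Y z (f v) \<le> \<epsilon> * H v + (1 - \<epsilon>) * r v"
        using mdist_triangle_of[OF zY f'(1)[OF v] fV[OF v]] f'(3)[OF v] \<epsilon>
        by (simp add: H_def mdist_commute_of[of Y "f' v" "f v"])
      then have "(mdist Y z (f v))\<^sup>2 \<le> (\<epsilon> * H v + (1 - \<epsilon>) * r v)\<^sup>2" by (intro power_mono mdist_nonneg_of)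
      also have "\<dots> = (1 - \<epsilon>) * (r v)\<^sup>2 + \<epsilon> * (H v)\<^sup>2 - \<epsilon> * (1 - \<epsilon>) * (H v - r v)\<^sup>2"
        by (simp add: power2_eq_square algebra_simps)
      also have "\<dots> \<le> (1 - \<epsilon>) * (r v)\<^sup>2 + \<epsilon> * (H v)\<^sup>2" using \<epsilon> by simp
      finally show "(mdist Y z (f v))\<^sup>2 \<le> (1 - \<epsilon>) * (r v)\<^sup>2 + \<epsilon> * (H v)\<^sup>2" .
    qed
    also have "\<dots> = (1 - \<epsilon>) * S + \<epsilon> * ?T"
      unfolding S_def sum_distrib_left sum.distrib[symmetric] by (intro sum.cong) (auto simp: algebra_simps)
    finally have "\<epsilon> * S \<le> \<epsilon> * ?T" by (simp add: algebra_simps)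
    then have "S \<le> ?T" using \<epsilon> by simp
    then have "(3/4) / real M * (S / 2) \<le> (3/4) / real M * (?T - 2 * (\<rho>\<^sup>2 / 4))"
      using M \<rho> by (intro mult_left_mono) auto
    also have "\<dots> \<le> 2 * (\<Lambda> * ?E)" using conc PP by linarith
    finally show ?thesis using M by (simp add: field_simps)
  qed
  finally show "(\<Sum>u\<in>V. \<Sum>v\<in>V. w u * w v * (mdist Y (f u) (f v))\<^sup>2) \<le> 64 / 3 * real M * \<Lambda> * ?E"
    by simp
qed

section \<open>Coverings at small scales\<close>

text \<open>
  Doubling is used twice, to pass from radius \<open>s\<close> to \<open>s / 2\<close> and then to \<open>s / 4\<close>.
\<close>

lemma uniformly_locally_doubling_imp_small_scale_covering:
  assumes "uniformly_locally_doubling Y N"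
  shows "small_scale_covering Y (nat \<lfloor>N\<rfloor> * nat \<lfloor>N\<rfloor>)"
  unfolding small_scale_covering_def
proof
  interpret Y: Metric_space "mspace Y" "mdist Y" by (rule Metric_space_mspace_mdist)
  fix b assume b: "b \<in> mspace Y"
  then obtain U W where UW: "openin (mtopology_of Y) W" "b \<in> W" "W \<subseteq> U" "U \<subseteq> mspace Y"
    and dbl: "doubling (submetric Y U) N"
    using assms unfolding uniformly_locally_doubling_def by blast
  have "\<exists>r>0. Y.mball b r \<subseteq> W"
    using UW(1,2) unfolding mtopology_of_def Y.openin_mtopology by auto
  then obtain s0 where s0: "0 < s0" "mball_of Y b s0 \<subseteq> U"
    using UW(3) by (auto simp: mball_of_def)
  have UY: "U \<inter> mspace Y = U" using UW by auto
  have dblU0: "\<forall>x\<in>U. \<forall>s>0. \<exists>C\<subseteq>U. finite C \<and> real (card C) \<le> N \<and>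
      mcball_of (submetric Y U) x s \<subseteq> (\<Union>c\<in>C. mcball_of (submetric Y U) c (s / 2))"
    using dbl unfolding doubling_def mspace_submetric UY .
  have dblU: "\<exists>C \<subseteq> U. finite C \<and> card C \<le> nat \<lfloor>N\<rfloor> \<and> mcball_of Y x s \<inter> U \<subseteq> (\<Union>c\<in>C. mcball_of Y c (s / 2))"
    if "x \<in> U" "0 < s" for x s
  proof -
    obtain C where C: "C \<subseteq> U" "finite C" "real (card C) \<le> N"
      "mcball_of (submetric Y U) x s \<subseteq> (\<Union>c\<in>C. mcball_of (submetric Y U) c (s / 2))"
      using dblU0[rule_format, OF \<open>x \<in> U\<close> \<open>0 < s\<close>] by blast
    have "mcball_of Y x s \<inter> U \<subseteq> mcball_of (submetric Y U) x s"
      using that(1) by (auto simp: subset_iff)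
    also note C(4)
    also have "(\<Union>c\<in>C. mcball_of (submetric Y U) c (s / 2)) \<subseteq> (\<Union>c\<in>C. mcball_of Y c (s / 2))"
      by (intro UN_mono) (auto simp: subset_iff)
    finally have "mcball_of Y x s \<inter> U \<subseteq> (\<Union>c\<in>C. mcball_of Y c (s / 2))" .
    moreover have "card C \<le> nat \<lfloor>N\<rfloor>" using C(3) by (rule le_nat_floor)
    ultimately show ?thesis using C(1,2) by blast
  qed
  show "\<exists>s0>0. \<forall>s. 0 < s \<and> s < s0 \<longrightarrow> (\<exists>C\<subseteq>mspace Y. finite C \<and> card C \<le> nat \<lfloor>N\<rfloor> * nat \<lfloor>N\<rfloor> \<and>
      mcball_of Y b s \<subseteq> (\<Union>c\<in>C. mcball_of Y c (s / 4)))"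
  proof (intro exI[of _ s0] conjI allI impI s0)
    fix s assume s: "0 < s \<and> s < s0"
    have "b \<in> U" using UW by auto
    with s obtain C where C: "C \<subseteq> U" "finite C" "card C \<le> nat \<lfloor>N\<rfloor>"
      "mcball_of Y b s \<inter> U \<subseteq> (\<Union>c\<in>C. mcball_of Y c (s / 2))"
      using dblU[of b s] by blast
    have "\<forall>c\<in>C. \<exists>D \<subseteq> U. finite D \<and> card D \<le> nat \<lfloor>N\<rfloor> \<and> mcball_of Y c (s / 2) \<inter> U \<subseteq> (\<Union>d\<in>D. mcball_of Y d (s / 2 / 2))"
      using C s by (intro ballI dblU) auto
    then obtain D where D: "\<And>c. c \<in> C \<Longrightarrow> D c \<subseteq> U" "\<And>c. c \<in> C \<Longrightarrow> finite (D c)" "\<And>c. c \<in> C \<Longrightarrow> card (D c) \<le> nat \<lfloor>N\<rfloor>"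
      "\<And>c. c \<in> C \<Longrightarrow> mcball_of Y c (s / 2) \<inter> U \<subseteq> (\<Union>d\<in>D c. mcball_of Y d (s / 2 / 2))"
      by metis
    have bU: "mcball_of Y b s \<subseteq> U" using s s0(2) by (auto simp: subset_iff)
    show "\<exists>C\<subseteq>mspace Y. finite C \<and> card C \<le> nat \<lfloor>N\<rfloor> * nat \<lfloor>N\<rfloor> \<and>
      mcball_of Y b s \<subseteq> (\<Union>c\<in>C. mcball_of Y c (s / 4))"
    proof (intro exI[of _ "\<Union>c\<in>C. D c"] conjI)
      have "card (\<Union>c\<in>C. D c) \<le> (\<Sum>c\<in>C. card (D c))" using C by (intro card_UN_le)
      also have "\<dots> \<le> card C * nat \<lfloor>N\<rfloor>" using sum_bounded_above[of C "\<lambda>c. card (D c)" "nat \<lfloor>N\<rfloor>"] D by simp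
      also have "\<dots> \<le> nat \<lfloor>N\<rfloor> * nat \<lfloor>N\<rfloor>" using C by (intro mult_right_mono) auto
      finally show "card (\<Union>c\<in>C. D c) \<le> nat \<lfloor>N\<rfloor> * nat \<lfloor>N\<rfloor>" .
      show "mcball_of Y b s \<subseteq> (\<Union>c\<in>(\<Union>c\<in>C. D c). mcball_of Y c (s / 4))"
      proof
        fix y assume y: "y \<in> mcball_of Y b s"
        then have "y \<in> U" "y \<in> (\<Union>c\<in>C. mcball_of Y c (s / 2))" using C(4) bU by (auto simp del: in_mcball_of)
        then obtain c where c: "c \<in> C" "y \<in> mcball_of Y c (s / 2) \<inter> U" by blast
        then obtain d where "d \<in> D c" "y \<in> mcball_of Y d (s / 2 / 2)" using D(4) by blast
        then show "y \<in> (\<Union>c\<in>(\<Union>c\<in>C. D c). mcball_of Y c (s / 4))" using c(1) by auto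
      qed
      show "(\<Union>c\<in>C. D c) \<subseteq> mspace Y" using D(1) UW(4) by blast
      show "finite (\<Union>c\<in>C. D c)" using C(2) D(2) by simp
    qed
  qed
qed

text \<open>
  Geodesic completeness only provides a local geodesic beyond \<open>x\<close>.  In a CAT(0) space it is a
  geodesic starting from \<open>b\<close>: Stewart's inequality with vertex \<open>x\<close>, for the point at distance \<open>h\<close>
  before \<open>x\<close> and the point at distance \<open>h\<close> after it, which are \<open>2 * h\<close> apart, makes the distance from
  \<open>b\<close> to the new point at least the length of the path.
\<close>

lemma geodesic_extension_step:
  assumes C: "CAT0 Y" and gc: "geodesically_complete Y" and b: "b \<in> mspace Y" and x: "x \<in> mspace Y"
    and bx: "b \<noteq> x" and e: "0 < e"
  obtains x' where "x' \<in> mspace Y" "0 < mdist Y x x'" "mdist Y x x' \<le> e" "mdist Y b x' = mdist Y b x + mdist Y x x'"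
proof -
  interpret Y: Metric_space "mspace Y" "mdist Y" by (rule Metric_space_mspace_mdist)
  let ?a = "mdist Y b x"
  have a: "0 < ?a" using b x bx by simp
  obtain \<gamma> where \<gamma>: "geodesic_on Y {0..?a} \<gamma>" "\<gamma> 0 = b" "\<gamma> ?a = x"
    using geopt_geodesic[OF C b x] unfolding geodesic_from_to_def by metis
  have "geodesic_on Y ({0..?a} \<inter> {t - 1<..<t + 1}) \<gamma>" for t
    using \<gamma>(1) is_interval_Int[OF is_interval_cc is_interval_oo, of 0 ?a "t - 1" "t + 1"]
    unfolding geodesic_on_def by auto
  then have "local_geodesic_on Y {0..?a} \<gamma>"
    unfolding local_geodesic_on_def using is_interval_cc zero_less_one by blast
  then have "\<exists>c>?a. \<exists>\<gamma>'. local_geodesic_on Y {0..c} \<gamma>' \<and> (\<forall>t\<in>{0..?a}. \<gamma>' t = \<gamma> t)"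
    using gc a unfolding geodesically_complete_def by simp
  then obtain c \<gamma>' where \<gamma>': "c > ?a" "local_geodesic_on Y {0..c} \<gamma>'" "\<And>t. t \<in> {0..?a} \<Longrightarrow> \<gamma>' t = \<gamma> t"
    by blast
  have "?a \<in> {0..c}" using a \<gamma>'(1) by simp
  then obtain e' where e': "0 < e'" "geodesic_on Y ({0..c} \<inter> {?a - e'<..<?a + e'}) \<gamma>'"
    using \<gamma>'(2) unfolding local_geodesic_on_def by blast
  define h where "h = min (min (e' / 2) (c - ?a)) (min e ?a)"
  have h: "0 < h" "h < e'" "?a + h \<le> c" "h \<le> e" "h \<le> ?a"
    using e e' \<gamma>'(1) a by (auto simp: h_def)
  have I: "?a \<in> {0..c} \<inter> {?a - e'<..<?a + e'}" "?a + h \<in> {0..c} \<inter> {?a - e'<..<?a + e'}" "?a - h \<in> {0..c} \<inter> {?a - e'<..<?a + e'}"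
    using h a by auto
  define x' where "x' = \<gamma>' (?a + h)"
  define y where "y = \<gamma> (?a - h)"
  have ends: "\<gamma>' ?a = x" "\<gamma>' (?a - h) = y" using \<gamma>' \<gamma> h a by (auto simp: y_def)
  have x': "x' \<in> mspace Y" using e' I by (auto simp: geodesic_on_def x'_def)
  have y: "y \<in> mspace Y" "mdist Y b y = ?a - h" "mdist Y x y = h"
  proof -
    show "y \<in> mspace Y" using \<gamma> h by (auto simp: geodesic_on_def y_def)
    have "mdist Y (\<gamma> 0) (\<gamma> (?a - h)) = \<bar>0 - (?a - h)\<bar>" "mdist Y (\<gamma> ?a) (\<gamma> (?a - h)) = \<bar>?a - (?a - h)\<bar>"
      using \<gamma>(1) h a unfolding geodesic_on_def by auto
    then show "mdist Y b y = ?a - h" "mdist Y x y = h" using \<gamma> h by (auto simp: y_def)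
  qed
  have xx': "mdist Y x x' = h"
  proof -
    have "mdist Y (\<gamma>' ?a) (\<gamma>' (?a + h)) = \<bar>?a - (?a + h)\<bar>"
      using e'(2) I unfolding geodesic_on_def by blast
    then show ?thesis using ends h by (simp add: x'_def)
  qed
  have yx': "mdist Y x' y = 2 * h"
  proof -
    have "mdist Y (\<gamma>' (?a + h)) (\<gamma>' (?a - h)) = \<bar>(?a + h) - (?a - h)\<bar>"
      using e'(2) I unfolding geodesic_on_def by blast
    then show ?thesis using ends h by (simp add: x'_def)
  qed
  let ?t = "h / ?a"
  have t: "?t \<in> {0..1}" using h a by auto
  have "y = geopt Y x ?t b"
  proof (rule geopt_unique[OF C x b y(1) t])
    show "mdist Y x y = ?t * mdist Y x b" using y a by (simp add: Y.commute[of x b])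
    show "mdist Y y b = (1 - ?t) * mdist Y x b" using y a by (simp add: Y.commute[of x b] Y.commute[of y b] algebra_simps)
  qed
  then have "(2 * h)\<^sup>2 \<le> (1 - ?t) * h\<^sup>2 + ?t * (mdist Y b x')\<^sup>2 - ?t * (1 - ?t) * ?a\<^sup>2"
    using geopt_Stewart[OF C x b x' t] yx' xx' by (simp add: Y.commute[of x' x] Y.commute[of x' b] Y.commute[of x b])
  then have "?a * (2 * h)\<^sup>2 \<le> ?a * ((1 - ?t) * h\<^sup>2 + ?t * (mdist Y b x')\<^sup>2 - ?t * (1 - ?t) * ?a\<^sup>2)"
    using a by (intro mult_left_mono) auto
  also have "\<dots> = (?a - h) * h\<^sup>2 + h * (mdist Y b x')\<^sup>2 - h * (?a - h) * ?a"
    using a by (simp add: field_simps power2_eq_square)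
  finally have "h * (?a + h)\<^sup>2 \<le> h * (mdist Y b x')\<^sup>2"
    by (simp add: power2_eq_square algebra_simps)
  then have "(?a + h)\<^sup>2 \<le> (mdist Y b x')\<^sup>2" using h by simp
  then have "?a + h \<le> mdist Y b x'" by (rule power2_le_imp_le) simp
  moreover have "mdist Y b x' \<le> ?a + h" using Y.triangle[OF b x x'] xx' by simp
  ultimately show thesis using that[of x'] x' xx' h by auto
qed

text \<open>
  Among the points \<open>x\<close> that prolong the geodesic from \<open>b\<close> to \<open>q\<close>
  and have distance at most \<open>T\<close> from \<open>b\<close>, there is a farthest one, by compactness; the extension step
  shows that its distance is \<open>T\<close>.
\<close>

lemma geodesic_extension:
  assumes C: "CAT0 Y" and gc: "geodesically_complete Y" and b: "b \<in> mspace Y" and q: "q \<in> mspace Y"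
    and bq: "b \<noteq> q" and T: "mdist Y b q \<le> T" and K: "compactin (mtopology_of Y) K" "mcball_of Y b T \<subseteq> K"
  obtains x where "x \<in> mspace Y" "mdist Y b x = T" "mdist Y b q + mdist Y q x = T"
proof -
  interpret Y: Metric_space "mspace Y" "mdist Y" by (rule Metric_space_mspace_mdist)
  define S where "S = {x \<in> mspace Y. mdist Y b q + mdist Y q x = mdist Y b x \<and> mdist Y b x \<le> T}"
  have qS: "q \<in> S" using q T by (auto simp: S_def)
  define D where "D = Sup (mdist Y b ` S)"
  have bdd: "bdd_above (mdist Y b ` S)" by (rule bdd_aboveI2[of _ _ T]) (simp add: S_def)
  have D: "mdist Y b x \<le> D" if "x \<in> S" for x unfolding D_def using that bdd by (intro cSup_upper) auto
  have "\<exists>x\<in>S. D - 1 / (real n + 1) < mdist Y b x" for n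
  proof -
    have "D - 1 / (real n + 1) < Sup (mdist Y b ` S)" by (simp add: D_def)
    then show ?thesis using qS bdd by (subst (asm) less_cSup_iff) auto
  qed
  then obtain \<sigma> where \<sigma>: "\<And>n. \<sigma> n \<in> S" "\<And>n. D - 1 / (real n + 1) < mdist Y b (\<sigma> n)" by metis
  have "range \<sigma> \<subseteq> K" using \<sigma> K b by (auto simp: S_def)
  moreover have "\<forall>\<sigma>::nat \<Rightarrow> _. range \<sigma> \<subseteq> K \<longrightarrow>
      (\<exists>l r. l \<in> K \<and> strict_mono r \<and> limitin Y.mtopology (\<sigma> \<circ> r) l sequentially)"
    using K(1) unfolding mtopology_of_def Y.compactin_sequentially by (rule conjunct2)
  ultimately obtain x r where x: "strict_mono r" "limitin (mtopology_of Y) (\<sigma> \<circ> r) x sequentially"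
    unfolding mtopology_of_def by blast
  have xY: "x \<in> mspace Y" using limitin_topspace[OF x(2)] by simp
  have rY: "range (\<sigma> \<circ> r) \<subseteq> mspace Y" using \<sigma> by (auto simp: S_def)
  note lim = limitin_mdist_tendsto[OF x(2) rY]
  have "(\<lambda>n. mdist Y b q + mdist Y q ((\<sigma> \<circ> r) n)) \<longlonglongrightarrow> mdist Y b q + mdist Y q x"
    by (intro tendsto_intros lim q)
  moreover have "(\<lambda>n. mdist Y b q + mdist Y q ((\<sigma> \<circ> r) n)) = (\<lambda>n. mdist Y b ((\<sigma> \<circ> r) n))"
    using \<sigma> by (auto simp: S_def)
  ultimately have e1: "mdist Y b q + mdist Y q x = mdist Y b x"
    using lim[OF b] LIMSEQ_unique by fastforce
  have e2: "mdist Y b x \<le> T"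
    using \<sigma> by (intro LIMSEQ_le_const2[OF lim[OF b]]) (auto simp: S_def)
  have xS: "x \<in> S" using xY e1 e2 by (auto simp: S_def)
  have "(\<lambda>n. D - 1 / (real n + 1)) \<longlonglongrightarrow> D - 0"
    using LIMSEQ_inverse_real_of_nat by (intro tendsto_intros) (simp add: field_simps)
  then have "((\<lambda>n. D - 1 / (real n + 1)) \<circ> r) \<longlonglongrightarrow> D"
    using LIMSEQ_subseq_LIMSEQ[OF _ x(1)] by simp
  then have Dx: "D \<le> mdist Y b x"
  proof (rule LIMSEQ_le[OF _ lim[OF b]])
    show "\<exists>N. \<forall>n\<ge>N. ((\<lambda>n. D - 1 / (real n + 1)) \<circ> r) n \<le> mdist Y b ((\<sigma> \<circ> r) n)"
      using less_imp_le[OF \<sigma>(2)] by auto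
  qed
  have "mdist Y b x = T"
  proof (rule ccontr)
    assume "mdist Y b x \<noteq> T"
    then have lt: "0 < T - mdist Y b x" using e2 by simp
    have "0 < mdist Y b q" using bq b q by simp
    then have "0 < mdist Y b x" using e1 Y.nonneg[of q x] by linarith
    then have "b \<noteq> x" using b by auto
    then obtain x' where x': "x' \<in> mspace Y" "0 < mdist Y x x'" "mdist Y x x' \<le> T - mdist Y b x"
      "mdist Y b x' = mdist Y b x + mdist Y x x'"
      using geodesic_extension_step[OF C gc b xY _ lt] by metis
    have "mdist Y b q + mdist Y q x' = mdist Y b x'"
      using Y.triangle[OF q xY x'(1)] Y.triangle[OF b q x'(1)] x'(4) e1 by linarith
    then have "x' \<in> S" using x' by (auto simp: S_def)
    then show False using D[of x'] Dx x' by simp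
  qed
  then show thesis using that[of x] xY e1 by auto
qed

text \<open>
  Properness speaks about one point; this is the corresponding statement for two.  If \<open>g\<close> and \<open>h\<close>
  both carry \<open>k\<close> near \<open>p\<close>, then the quotient of \<open>g\<close> by \<open>h\<close> moves \<open>k\<close> by little, so it belongs to the
  finite set that properness provides at \<open>k\<close>.
\<close>

lemma proper_action_finite_transporter:
  fixes \<Gamma> :: "('g, 'm) monoid_scheme" and Y :: "'a metric"
  assumes act: "isometric_action \<Gamma> Y \<phi>" and pr: "proper_action \<Gamma> Y \<phi>"
    and p: "p \<in> mspace Y" and k: "k \<in> mspace Y"
  obtains s where "0 < s" "finite {g \<in> carrier \<Gamma>. \<phi> g ` mball_of Y k s \<inter> mball_of Y p s \<noteq> {}}"
proof -
  interpret Y: Metric_space "mspace Y" "mdist Y" by (rule Metric_space_mspace_mdist)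
  interpret group_action \<Gamma> "mspace Y" \<phi> using act by (simp add: isometric_action_def)
  interpret G: group \<Gamma> using group_hom by (simp add: group_hom_def)
  have iso: "mdist Y (\<phi> g x) (\<phi> g y) = mdist Y x y" if "g \<in> carrier \<Gamma>" "x \<in> mspace Y" "y \<in> mspace Y" for g x y
    using act that by (simp add: isometric_action_def)
  have mem: "\<phi> g x \<in> mspace Y" if "g \<in> carrier \<Gamma>" "x \<in> mspace Y" for g x
    using element_image[OF that] by simp
  obtain r where r: "0 < r" "finite {g \<in> carrier \<Gamma>. \<phi> g ` mball_of Y k r \<inter> mball_of Y k r \<noteq> {}}"
    using pr k unfolding proper_action_def by blast
  let ?S = "{g \<in> carrier \<Gamma>. \<phi> g ` mball_of Y k r \<inter> mball_of Y k r \<noteq> {}}"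
  let ?T = "{g \<in> carrier \<Gamma>. \<phi> g ` mball_of Y k (r / 4) \<inter> mball_of Y p (r / 4) \<noteq> {}}"
  have near: "mdist Y (\<phi> g k) p < r / 2" if g: "g \<in> ?T" for g
  proof -
    obtain x where x: "x \<in> mball_of Y k (r / 4)" "\<phi> g x \<in> mball_of Y p (r / 4)" using g by blast
    have gc: "g \<in> carrier \<Gamma>" using g by simp
    have xY: "x \<in> mspace Y" using x by simp
    have "mdist Y (\<phi> g k) p \<le> mdist Y (\<phi> g k) (\<phi> g x) + mdist Y (\<phi> g x) p"
      by (intro Y.triangle mem gc k xY p)
    then show ?thesis using x iso[OF gc k xY] by (simp add: Y.commute[of "\<phi> g x" p])
  qed
  have "finite ?T"
  proof (cases "?T = {}")
    case False
    then obtain h where h: "h \<in> ?T" by blast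
    have hc: "h \<in> carrier \<Gamma>" using h by simp
    have "(\<lambda>g. inv\<^bsub>\<Gamma>\<^esub> h \<otimes>\<^bsub>\<Gamma>\<^esub> g) ` ?T \<subseteq> ?S"
    proof clarify
      fix g assume g: "g \<in> carrier \<Gamma>" "\<phi> g ` mball_of Y k (r / 4) \<inter> mball_of Y p (r / 4) \<noteq> {}"
      then have gT: "g \<in> ?T" by simp
      have m: "\<phi> g k \<in> mspace Y" "\<phi> h k \<in> mspace Y" using g hc k mem by auto
      have "mdist Y (\<phi> g k) (\<phi> h k) \<le> mdist Y (\<phi> g k) p + mdist Y p (\<phi> h k)" by (intro Y.triangle m p)
      then have d: "mdist Y (\<phi> g k) (\<phi> h k) < r" using near[OF gT] near[OF h] by (simp add: Y.commute[of p])
      have inv: "\<phi> (inv\<^bsub>\<Gamma>\<^esub> h) (\<phi> h k) = k"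
        by (rule orbit_sym_aux[OF hc k refl])
      have "\<phi> (inv\<^bsub>\<Gamma>\<^esub> h \<otimes>\<^bsub>\<Gamma>\<^esub> g) k = \<phi> (inv\<^bsub>\<Gamma>\<^esub> h) (\<phi> g k)"
        using composition_rule[OF k _ g(1)] hc by simp
      then have "mdist Y (\<phi> (inv\<^bsub>\<Gamma>\<^esub> h \<otimes>\<^bsub>\<Gamma>\<^esub> g) k) k = mdist Y (\<phi> g k) (\<phi> h k)"
        using iso[OF G.inv_closed[OF hc] m] inv by simp
      then have "\<phi> (inv\<^bsub>\<Gamma>\<^esub> h \<otimes>\<^bsub>\<Gamma>\<^esub> g) k \<in> mball_of Y k r"
        using d k mem[OF _ k] g hc by (simp add: Y.commute[of k])
      moreover have "k \<in> mball_of Y k r" using k r by simp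
      ultimately show "inv\<^bsub>\<Gamma>\<^esub> h \<otimes>\<^bsub>\<Gamma>\<^esub> g \<in> carrier \<Gamma> \<and>
          \<phi> (inv\<^bsub>\<Gamma>\<^esub> h \<otimes>\<^bsub>\<Gamma>\<^esub> g) ` mball_of Y k r \<inter> mball_of Y k r \<noteq> {}"
        using g(1) hc by blast
    qed
    then have "finite ((\<lambda>g. inv\<^bsub>\<Gamma>\<^esub> h \<otimes>\<^bsub>\<Gamma>\<^esub> g) ` ?T)" using r(2) by (rule finite_subset)
    moreover have "inj_on (\<lambda>g. inv\<^bsub>\<Gamma>\<^esub> h \<otimes>\<^bsub>\<Gamma>\<^esub> g) ?T"
      using hc by (auto intro!: inj_onI)
    ultimately show ?thesis by (rule finite_imageD)
  qed (simp only: finite.emptyI)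
  then show thesis using r by (intro that[of "r / 4"]) auto
qed

lemma openin_mball_of: "openin (mtopology_of Y) (mball_of Y x r)"
proof -
  interpret Y: Metric_space "mspace Y" "mdist Y" by (rule Metric_space_mspace_mdist)
  show ?thesis unfolding mtopology_of_def mball_of_def by (rule Y.openin_mball)
qed

lemma compactin_cover_mballs:
  assumes K: "compactin (mtopology_of Y) K" and s: "\<And>k. k \<in> K \<Longrightarrow> 0 < s k"
  obtains K0 where "finite K0" "K0 \<subseteq> K" "K \<subseteq> (\<Union>k\<in>K0. mball_of Y k (s k))"
proof -
  interpret Y: Metric_space "mspace Y" "mdist Y" by (rule Metric_space_mspace_mdist)
  let ?U = "\<lambda>k. mball_of Y k (s k)"
  have "K \<subseteq> mspace Y" using compactin_subset_topspace[OF K] by simp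
  then have "k \<in> ?U k" if "k \<in> K" for k using that s[OF that] by auto
  then have "K \<subseteq> \<Union>(?U ` K)" by blast
  moreover have "openin (mtopology_of Y) U" if "U \<in> ?U ` K" for U
    using that by (auto simp: openin_mball_of)
  ultimately obtain \<F> where \<F>: "finite \<F>" "\<F> \<subseteq> ?U ` K" "K \<subseteq> \<Union>\<F>"
    using compactinD[OF K, of "?U ` K"] by blast
  obtain K0 where "K0 \<subseteq> K" "finite K0" "\<F> = ?U ` K0"
    using finite_subset_image[OF \<F>(1,2)] by blast
  with \<F>(3) show thesis by (intro that[of K0]) auto
qed

lemma isometric_action_compact_image:
  assumes act: "isometric_action \<Gamma> Y \<phi>" and g: "g \<in> carrier \<Gamma>" and K: "compactin (mtopology_of Y) K"
  shows "compactin (mtopology_of Y) (\<phi> g ` K)"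
proof (rule image_compactin[OF K])
  interpret group_action \<Gamma> "mspace Y" \<phi> using act by (simp add: isometric_action_def)
  have mem: "\<phi> g x \<in> mspace Y" if "x \<in> mspace Y" for x
    using element_image[OF g that] by simp
  have "Lipschitz_continuous_map Y Y (\<phi> g)"
    unfolding Lipschitz_continuous_map_def
    using act g mem by (auto simp: isometric_action_def intro!: exI[of _ 1])
  then show "continuous_map (mtopology_of Y) (mtopology_of Y) (\<phi> g)"
    by (rule Lipschitz_continuous_imp_continuous_map)
qed

text \<open>
  Near a point \<open>p\<close> only finitely many translates of the compact fundamental set \<open>K\<close> occur, and they cover a ball around
  \<open>p\<close>.  A Lebesgue number for the cover of \<open>K\<close> by finitely many such balls is a radius that works for
  all points of \<open>K\<close>, and hence for all points by translation.
\<close>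

lemma cocompact_proper_uniform_compact_balls:
  fixes \<Gamma> :: "('g, 'm) monoid_scheme" and Y :: "'a metric"
  assumes act: "isometric_action \<Gamma> Y \<phi>" and co: "cocompact_action \<Gamma> Y \<phi>" and pr: "proper_action \<Gamma> Y \<phi>"
  obtains R H where "0 < R" "compactin (mtopology_of Y) H"
    "\<forall>b\<in>mspace Y. \<exists>g\<in>carrier \<Gamma>. mcball_of Y b R \<subseteq> \<phi> g ` H"
proof -
  interpret Y: Metric_space "mspace Y" "mdist Y" by (rule Metric_space_mspace_mdist)
  interpret group_action \<Gamma> "mspace Y" \<phi> using act by (simp add: isometric_action_def)
  have iso: "mdist Y (\<phi> g x) (\<phi> g y) = mdist Y x y" if "g \<in> carrier \<Gamma>" "x \<in> mspace Y" "y \<in> mspace Y" for g x y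
    using act that by (simp add: isometric_action_def)
  have mem: "\<phi> g x \<in> mspace Y" if "g \<in> carrier \<Gamma>" "x \<in> mspace Y" for g x
    using element_image[OF that] by simp
  obtain K where K: "compactin (mtopology_of Y) K" "mspace Y = (\<Union>g \<in> carrier \<Gamma>. \<phi> g ` K)"
    using co unfolding cocompact_action_def by blast
  have KY: "K \<subseteq> mspace Y" using compactin_subset_topspace[OF K(1)] by simp
  have local: "\<exists>s G0. 0 < s \<and> finite G0 \<and> G0 \<subseteq> carrier \<Gamma> \<and> mball_of Y p s \<subseteq> (\<Union>g\<in>G0. \<phi> g ` K)"
    if p: "p \<in> mspace Y" for p
  proof -
    have "\<exists>s>0. finite {g \<in> carrier \<Gamma>. \<phi> g ` mball_of Y k s \<inter> mball_of Y p s \<noteq> {}}" if "k \<in> K" for k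
      by (rule proper_action_finite_transporter[OF act pr p subsetD[OF KY that]]) blast
    then have "\<forall>k\<in>K. \<exists>s. 0 < s \<and> finite {g \<in> carrier \<Gamma>. \<phi> g ` mball_of Y k s \<inter> mball_of Y p s \<noteq> {}}"
      by blast
    from bchoice[OF this] obtain s where s: "\<And>k. k \<in> K \<Longrightarrow> 0 < s k"
      "\<And>k. k \<in> K \<Longrightarrow> finite {g \<in> carrier \<Gamma>. \<phi> g ` mball_of Y k (s k) \<inter> mball_of Y p (s k) \<noteq> {}}"
      by blast
    obtain K0 where K0: "finite K0" "K0 \<subseteq> K" "K \<subseteq> (\<Union>k\<in>K0. mball_of Y k (s k))"
      by (rule compactin_cover_mballs[OF K(1) s(1)])
    define s0 where "s0 = Min (insert 1 (s ` K0))"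
    have s0: "0 < s0" "\<And>k. k \<in> K0 \<Longrightarrow> s0 \<le> s k"
      using K0 s(1) by (auto simp: s0_def)
    define G0 where "G0 = (\<Union>k\<in>K0. {g \<in> carrier \<Gamma>. \<phi> g ` mball_of Y k (s k) \<inter> mball_of Y p (s k) \<noteq> {}})"
    have "mball_of Y p s0 \<subseteq> (\<Union>g\<in>G0. \<phi> g ` K)"
    proof
      fix x assume x: "x \<in> mball_of Y p s0"
      then have "x \<in> mspace Y" by simp
      then obtain g k where g: "g \<in> carrier \<Gamma>" and k: "k \<in> K" "x = \<phi> g k" using K(2) by blast
      obtain k0 where k0: "k0 \<in> K0" "k \<in> mball_of Y k0 (s k0)" using K0 k by blast
      have "x \<in> mball_of Y p (s k0)" using x s0(2)[OF k0(1)] by auto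
      then have "g \<in> G0" unfolding G0_def using g k k0 by blast
      then show "x \<in> (\<Union>g\<in>G0. \<phi> g ` K)" using k by blast
    qed
    moreover have "finite G0" "G0 \<subseteq> carrier \<Gamma>" using K0 s(2) unfolding G0_def by auto
    ultimately show ?thesis using s0(1) by blast
  qed
  then have "\<forall>p\<in>mspace Y. \<exists>z. 0 < fst z \<and> finite (snd z) \<and> snd z \<subseteq> carrier \<Gamma> \<and>
      mball_of Y p (fst z) \<subseteq> (\<Union>g\<in>snd z. \<phi> g ` K)"
    by simp
  from bchoice[OF this] obtain z where z: "\<forall>p\<in>mspace Y. 0 < fst (z p) \<and> finite (snd (z p)) \<and>
      snd (z p) \<subseteq> carrier \<Gamma> \<and> mball_of Y p (fst (z p)) \<subseteq> (\<Union>g\<in>snd (z p). \<phi> g ` K)" ..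
  define s G0 where "s = fst \<circ> z" and "G0 = snd \<circ> z"
  then have s: "\<And>p. p \<in> mspace Y \<Longrightarrow> 0 < s p" "\<And>p. p \<in> mspace Y \<Longrightarrow> finite (G0 p)"
    "\<And>p. p \<in> mspace Y \<Longrightarrow> G0 p \<subseteq> carrier \<Gamma>" "\<And>p. p \<in> mspace Y \<Longrightarrow> mball_of Y p (s p) \<subseteq> (\<Union>g\<in>G0 p. \<phi> g ` K)"
    using z by auto
  obtain P where P: "finite P" "P \<subseteq> K" "K \<subseteq> (\<Union>p\<in>P. mball_of Y p (s p))"
    by (rule compactin_cover_mballs[OF K(1) s(1)[OF subsetD[OF KY]]])
  have "\<exists>e>0. \<forall>x\<in>K. \<exists>U\<in>(\<lambda>p. mball_of Y p (s p)) ` P. Y.mball x e \<subseteq> U"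
    using K(1) P(3) openin_mball_of by (intro Y.lebesgue_number) (auto simp: mtopology_of_def)
  then obtain e where e: "0 < e" "\<And>x. x \<in> K \<Longrightarrow> \<exists>p\<in>P. mball_of Y x e \<subseteq> mball_of Y p (s p)"
    unfolding mball_of_def by blast
  define H where "H = (\<Union>p\<in>P. \<Union>g\<in>G0 p. \<phi> g ` K)"
  have PY: "P \<subseteq> mspace Y" using P KY by blast
  show thesis
  proof (rule that[of "e / 2" H])
    show "compactin (mtopology_of Y) H"
      unfolding H_def
    proof (intro compactin_Union)
      fix S assume "S \<in> (\<lambda>p. \<Union>g\<in>G0 p. \<phi> g ` K) ` P"
      then obtain p where p: "p \<in> P" "S = (\<Union>g\<in>G0 p. \<phi> g ` K)" by blast
      then have pY: "p \<in> mspace Y" using PY by blast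
      have "compactin (mtopology_of Y) T" if "T \<in> (\<lambda>g. \<phi> g ` K) ` G0 p" for T
        using that s(3)[OF pY] isometric_action_compact_image[OF act _ K(1)] by auto
      then show "compactin (mtopology_of Y) S"
        unfolding p using s(2)[OF pY] by (intro compactin_Union) auto
    qed (use P in auto)
    show "\<forall>b\<in>mspace Y. \<exists>g\<in>carrier \<Gamma>. mcball_of Y b (e / 2) \<subseteq> \<phi> g ` H"
    proof
      fix b assume "b \<in> mspace Y"
      then obtain g k where g: "g \<in> carrier \<Gamma>" and k: "k \<in> K" "b = \<phi> g k" using K(2) by blast
      have kY: "k \<in> mspace Y" using k KY by blast
      obtain p where p: "p \<in> P" "mball_of Y k e \<subseteq> mball_of Y p (s p)" using e k by blast
      then have kH: "mball_of Y k e \<subseteq> H" using s(4)[of p] PY unfolding H_def by blast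
      have "mcball_of Y b (e / 2) \<subseteq> \<phi> g ` H"
      proof
        fix y assume y: "y \<in> mcball_of Y b (e / 2)"
        then have yY: "y \<in> mspace Y" by simp
        then obtain x where x: "x \<in> mspace Y" "y = \<phi> g x" using bij_prop1[OF g yY] by blast
        have "mdist Y k x \<le> e / 2" using y iso[OF g kY x(1)] k x by simp
        then have "x \<in> mball_of Y k e" using e kY x by simp
        then show "y \<in> \<phi> g ` H" using kH x by blast
      qed
      then show "\<exists>g\<in>carrier \<Gamma>. mcball_of Y b (e / 2) \<subseteq> \<phi> g ` H" using g by blast
    qed
  qed (use e in auto)
qed

text \<open>
  Extendability of geodesics transports a covering at the fixed scale \<open>R\<close> to all smaller scales: a
  point near \<open>b\<close> is the image, under the contracting homothety with ratio \<open>s / R\<close>, of a point in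
  the ball of radius \<open>R\<close>, and balls of radius \<open>R\<close> are covered uniformly by translates of the compact
  set \<open>H\<close>.
\<close>

lemma cocompact_proper_small_scale_covering:
  fixes \<Gamma> :: "('g, 'm) monoid_scheme" and Y :: "'a metric"
  assumes C: "CAT0 Y" and gc: "geodesically_complete Y"
    and act: "isometric_action \<Gamma> Y \<phi>" and co: "cocompact_action \<Gamma> Y \<phi>" and pr: "proper_action \<Gamma> Y \<phi>"
  obtains M where "small_scale_covering Y M"
proof -
  interpret Y: Metric_space "mspace Y" "mdist Y" by (rule Metric_space_mspace_mdist)
  interpret group_action \<Gamma> "mspace Y" \<phi> using act by (simp add: isometric_action_def)
  have iso: "mdist Y (\<phi> g x) (\<phi> g y) = mdist Y x y" if "g \<in> carrier \<Gamma>" "x \<in> mspace Y" "y \<in> mspace Y" for g x y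
    using act that by (simp add: isometric_action_def)
  have mem: "\<phi> g x \<in> mspace Y" if "g \<in> carrier \<Gamma>" "x \<in> mspace Y" for g x
    using element_image[OF that] by simp
  obtain R H where R: "0 < R" and H: "compactin (mtopology_of Y) H"
    and RH: "\<forall>b\<in>mspace Y. \<exists>g\<in>carrier \<Gamma>. mcball_of Y b R \<subseteq> \<phi> g ` H"
    by (rule cocompact_proper_uniform_compact_balls[OF act co pr])
  have HY: "H \<subseteq> mspace Y" using compactin_subset_topspace[OF H] by simp
  have "Y.mtotally_bounded H" using H by (intro Y.compactin_imp_mtotally_bounded) (simp add: mtopology_of_def)
  moreover have "0 < R / 4" using R by simp
  ultimately have "\<exists>N. finite N \<and> N \<subseteq> H \<and> H \<subseteq> (\<Union>x\<in>N. Y.mball x (R / 4))"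
    unfolding Y.mtotally_bounded_def by (elim allE impE)
  then obtain N where N: "finite N" "N \<subseteq> H" "H \<subseteq> (\<Union>x\<in>N. Y.mball x (R / 4))"
    by (elim exE conjE)
  have "small_scale_covering Y (card N)"
    unfolding small_scale_covering_def
  proof (intro ballI exI[of _ R] conjI allI impI R)
    fix b s assume b: "b \<in> mspace Y" and s: "0 < s \<and> s < R"
    obtain g where g: "g \<in> carrier \<Gamma>" "mcball_of Y b R \<subseteq> \<phi> g ` H" using RH b by blast
    have gN: "\<phi> g c \<in> mspace Y" if "c \<in> N" for c using that N HY mem[OF g(1)] by blast
    have t: "s / R \<in> {0..1}" using s by auto
    define D where "D = (\<lambda>c. geopt Y b (s / R) (\<phi> g c)) ` N"
    have "mcball_of Y b s \<subseteq> (\<Union>c\<in>D. mcball_of Y c (s / 4))"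
    proof
      fix q assume "q \<in> mcball_of Y b s"
      then have q: "q \<in> mspace Y" "mdist Y b q \<le> s" by auto
      have "\<exists>x. x \<in> mspace Y \<and> mdist Y b x = R / s * mdist Y b q \<and> mdist Y b q + mdist Y q x = R / s * mdist Y b q"
      proof (cases "b = q")
        case True
        then show ?thesis using b by (intro exI[of _ b]) auto
      next
        case False
        have T: "mdist Y b q \<le> R / s * mdist Y b q" "R / s * mdist Y b q \<le> R"
          using s q mult_right_mono[of 1 "R / s" "mdist Y b q"] mult_left_mono[of "mdist Y b q" s "R / s"] by auto
        have "mcball_of Y b (R / s * mdist Y b q) \<subseteq> \<phi> g ` H"
        proof -
          have "mcball_of Y b (R / s * mdist Y b q) \<subseteq> mcball_of Y b R" using T(2) by auto
          then show ?thesis using g(2) by (rule subset_trans)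
        qed
        then obtain x where "x \<in> mspace Y" "mdist Y b x = R / s * mdist Y b q" "mdist Y b q + mdist Y q x = R / s * mdist Y b q"
          by (rule geodesic_extension[OF C gc b q(1) False T(1) isometric_action_compact_image[OF act g(1) H]])
        then show ?thesis by blast
      qed
      then obtain x where x: "x \<in> mspace Y" "mdist Y b x = R / s * mdist Y b q" "mdist Y b q + mdist Y q x = mdist Y b x"
        by auto
      have bq: "mdist Y b q = s / R * mdist Y b x" using x s by simp
      have qx: "q = geopt Y b (s / R) x"
      proof (rule geopt_unique[OF C b x(1) q(1) t bq])
        show "mdist Y q x = (1 - s / R) * mdist Y b x" using x(3) bq by (simp add: algebra_simps)
      qed
      have "mdist Y b x \<le> R"
        using q s x(2) mult_left_mono[of "mdist Y b q" s "R / s"] by simp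
      then have "x \<in> mcball_of Y b R" using b x by simp
      then obtain h where h: "h \<in> H" "x = \<phi> g h" using g by blast
      then obtain c where c: "c \<in> N" "h \<in> Y.mball c (R / 4)" using N by blast
      have "mdist Y (\<phi> g c) x < R / 4" using c h iso[OF g(1), of c h] by simp
      then have "s / R * mdist Y (\<phi> g c) x \<le> s / R * (R / 4)" using s by (intro mult_left_mono) auto
      also have "\<dots> = s / 4" using R by simp
      finally have "mdist Y (geopt Y b (s / R) (\<phi> g c)) q \<le> s / 4"
        using geopt_contract[OF C b gN[OF c(1)] x(1) t] unfolding qx by linarith
      moreover have "geopt Y b (s / R) (\<phi> g c) \<in> mspace Y"
        by (rule geopt_simps(1)[OF C b gN[OF c(1)] t])
      ultimately show "q \<in> (\<Union>c\<in>D. mcball_of Y c (s / 4))" using c q unfolding D_def by auto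
    qed
    moreover have "D \<subseteq> mspace Y" unfolding D_def using geopt_simps(1)[OF C b gN t] by blast
    moreover have "finite D" "card D \<le> card N" using N by (auto simp: D_def card_image_le)
    ultimately show "\<exists>D\<subseteq>mspace Y. finite D \<and> card D \<le> card N \<and> mcball_of Y b s \<subseteq> (\<Union>c\<in>D. mcball_of Y c (s / 4))"
      by (intro exI[of _ D] conjI)
  qed
  then show thesis by (rule that)
qed

section \<open>Products and isometries\<close>

lemma isometric_spaces_retract:
  assumes "isometric_spaces X Y"
  shows isometric_CAT0: "CAT0 X \<Longrightarrow> CAT0 Y" and isometric_mcomplete: "mcomplete_of X \<Longrightarrow> mcomplete_of Y"
proof -
  obtain h where h: "h ` mspace X = mspace Y"
    and iso: "\<And>x y. x \<in> mspace X \<Longrightarrow> y \<in> mspace X \<Longrightarrow> mdist Y (h x) (h y) = mdist X x y"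
    using assms unfolding isometric_spaces_def by blast
  let ?j = "inv_into (mspace X) h"
  have hj: "h (?j y) = y" "?j y \<in> mspace X" if "y \<in> mspace Y" for y
    using that h by (auto simp: f_inv_into_f inv_into_into)
  have jm: "?j \<in> mspace Y \<rightarrow> mspace X" using hj by auto
  have jd: "mdist X (?j x) (?j y) = mdist Y x y" if "x \<in> mspace Y" "y \<in> mspace Y" for x y
    using iso[of "?j x" "?j y"] hj that by simp
  have hm: "h \<in> mspace X \<rightarrow> mspace Y" using h by auto
  show "CAT0 X \<Longrightarrow> CAT0 Y"
    by (rule CAT0_retract[OF jm jd hm]) (auto simp: iso hj)
  show "mcomplete_of X \<Longrightarrow> mcomplete_of Y"
    by (rule mcomplete_retract[OF jm jd hm]) (auto simp: iso hj)
qed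

context
  fixes I :: "'i set" and F :: "'i \<Rightarrow> 'a metric" and p :: "'i \<Rightarrow> 'a"
  assumes p: "\<And>i. i \<in> I \<Longrightarrow> p i \<in> mspace (F i)"
begin

text \<open>
  A factor is identified with the slice through the base point; the coordinate projection is a
  1-Lipschitz retraction onto it.
\<close>

lemma l2_product_factor_retract:
  assumes i: "i \<in> I"
  shows l2_product_factor_CAT0: "CAT0 (l2_product I F p) \<Longrightarrow> CAT0 (F i)"
    and l2_product_factor_mcomplete: "mcomplete_of (l2_product I F p) \<Longrightarrow> mcomplete_of (F i)"
proof -
  let ?P = "l2_product I F p"
  note sp = mspace_l2_product[of I p F, OF p] and di = mdist_l2_product[of I p F, OF p]
  have zero: "mdist (F k) x x = 0" if "x \<in> mspace (F k)" for k x
    using that by (simp add: Metric_space.zero[OF Metric_space_mspace_mdist])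
  define j where "j x = (\<lambda>k\<in>I. if k = i then x else p k)" for x
  have single: "((\<lambda>k. (mdist (F k) (j x k) (j y k))\<^sup>2) has_sum (mdist (F i) x y)\<^sup>2) I"
    if "x \<in> mspace (F i)" "y \<in> mspace (F i)" for x y
  proof -
    have "((\<lambda>k. (mdist (F k) (j x k) (j y k))\<^sup>2) has_sum (mdist (F i) x y)\<^sup>2) {i}"
      using i by (intro has_sum_finiteI) (auto simp: j_def)
    then show ?thesis
      using has_sum_cong_neutral[of I "{i}" "\<lambda>k. (mdist (F k) (j x k) (j y k))\<^sup>2" "\<lambda>k. (mdist (F k) (j x k) (j y k))\<^sup>2"] i
      by (auto simp: j_def zero p)
  qed
  have jP: "j x \<in> l2_prod_carrier I F p" if x: "x \<in> mspace (F i)" for x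
  proof -
    have "(\<lambda>k. (mdist (F k) (p k) (j x k))\<^sup>2) summable_on I"
    proof -
      have "(\<lambda>k. (mdist (F k) (j (p i) k) (j x k))\<^sup>2) summable_on I"
        using single[OF p[OF i] x] by (auto simp: summable_on_def)
      then show ?thesis
        by (rule summable_on_cong[THEN iffD1, rotated]) (auto simp: j_def)
    qed
    then show ?thesis using x p by (auto simp: l2_prod_carrier_def j_def)
  qed
  have jm: "j \<in> mspace (F i) \<rightarrow> mspace ?P" using jP sp by auto
  have jd: "mdist ?P (j x) (j y) = mdist (F i) x y" if "x \<in> mspace (F i)" "y \<in> mspace (F i)" for x y
    using infsumI[OF single[OF that]] by (simp add: di l2_prod_dist_def mdist_nonneg_of)
  have \<pi>m: "(\<lambda>x. x i) \<in> mspace ?P \<rightarrow> mspace (F i)"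
    using i by (auto simp: sp l2_prod_carrier_def PiE_iff)
  have \<pi>d: "mdist (F i) (x i) (y i) \<le> mdist ?P x y" if "x \<in> mspace ?P" "y \<in> mspace ?P" for x y
  proof -
    have "sum (\<lambda>i. (mdist (F i) (x i) (y i))\<^sup>2) {i} \<le> (\<Sum>\<^sub>\<infinity>i\<in>I. (mdist (F i) (x i) (y i))\<^sup>2)"
      using that i by (intro finite_sum_le_infsum l2_prod_summable[of I p F, OF p]) (auto simp: sp)
    then show ?thesis
      by (simp add: di l2_prod_dist_def real_le_rsqrt)
  qed
  have \<pi>j: "j x i = x" for x using i by (simp add: j_def)
  show "CAT0 ?P \<Longrightarrow> CAT0 (F i)"
    by (rule CAT0_retract[OF jm jd \<pi>m]) (auto simp: \<pi>d \<pi>j)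
  show "mcomplete_of ?P \<Longrightarrow> mcomplete_of (F i)"
    by (rule mcomplete_retract[OF jm jd \<pi>m]) (auto simp: \<pi>d \<pi>j)
qed

lemma has_sum_weighted_sum:
  fixes g :: "'b \<Rightarrow> 'i \<Rightarrow> real"
  assumes "\<And>k. k \<in> K \<Longrightarrow> (g k has_sum s k) J"
  shows "((\<lambda>i. \<Sum>k\<in>K. c k * g k i) has_sum (\<Sum>k\<in>K. c k * s k)) J"
proof -
  have "((\<lambda>A. \<Sum>k\<in>K. c k * sum (g k) A) \<longlongrightarrow> (\<Sum>k\<in>K. c k * s k)) (finite_subsets_at_top J)"
    using assms unfolding has_sum_def by (intro tendsto_intros) auto
  also have "(\<lambda>A. \<Sum>k\<in>K. c k * sum (g k) A) = sum (\<lambda>i. \<Sum>k\<in>K. c k * g k i)"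
    by (rule ext) (subst sum.swap, simp add: sum_distrib_left)
  finally show ?thesis by (simp add: has_sum_def)
qed

text \<open>
  Both sides of a Poincare inequality are linear in the squared metric, which is the sum of the
  squared metrics of the factors.  This is why products, even infinite ones, cost nothing.
\<close>

lemma poincare_l2_product:
  assumes P: "\<And>i. i \<in> I \<Longrightarrow> poincare_inequality V w A \<Lambda> (F i)" and A: "A \<subseteq> V \<times> V"
  shows "poincare_inequality V w A \<Lambda> (l2_product I F p)"
  unfolding poincare_inequality_def
proof
  let ?P = "l2_product I F p"
  note sp = mspace_l2_product[of I p F, OF p] and di = mdist_l2_product[of I p F, OF p]
  fix f assume f: "f \<in> V \<rightarrow> mspace ?P"
  let ?g = "\<lambda>k i. (mdist (F i) (f (fst k) i) (f (snd k) i))\<^sup>2"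
  have fV: "f v \<in> l2_prod_carrier I F p" if "v \<in> V" for v using f that sp by auto
  have hs: "(?g k has_sum (mdist ?P (f (fst k)) (f (snd k)))\<^sup>2) I" if "k \<in> V \<times> V" for k
  proof -
    have "?g k summable_on I"
      using that by (intro l2_prod_summable[of I p F, OF p] fV) auto
    then show ?thesis
      by (simp add: di l2_prod_dist_def infsum_nonneg)
  qed
  have "(\<Sum>k\<in>V \<times> V. (w (fst k) * w (snd k)) * (mdist ?P (f (fst k)) (f (snd k)))\<^sup>2)
      \<le> (\<Sum>k\<in>A. \<Lambda> * (mdist ?P (f (fst k)) (f (snd k)))\<^sup>2)"
  proof (rule has_sum_mono)
    show "((\<lambda>i. \<Sum>k\<in>V \<times> V. (w (fst k) * w (snd k)) * ?g k i) has_sum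
        (\<Sum>k\<in>V \<times> V. (w (fst k) * w (snd k)) * (mdist ?P (f (fst k)) (f (snd k)))\<^sup>2)) I"
      by (rule has_sum_weighted_sum[OF hs])
    show "((\<lambda>i. \<Sum>k\<in>A. \<Lambda> * ?g k i) has_sum (\<Sum>k\<in>A. \<Lambda> * (mdist ?P (f (fst k)) (f (snd k)))\<^sup>2)) I"
      using A by (intro has_sum_weighted_sum hs) auto
    fix i assume i: "i \<in> I"
    then have "(\<lambda>v. f v i) \<in> V \<rightarrow> mspace (F i)" using fV by (auto simp: l2_prod_carrier_def PiE_iff)
    from P[OF i, unfolded poincare_inequality_def, rule_format, OF this]
    show "(\<Sum>k\<in>V \<times> V. (w (fst k) * w (snd k)) * ?g k i) \<le> (\<Sum>k\<in>A. \<Lambda> * ?g k i)"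
      by (simp add: sum.cartesian_product case_prod_unfold sum_distrib_left)
  qed
  then show "(\<Sum>u\<in>V. \<Sum>v\<in>V. w u * w v * (mdist ?P (f u) (f v))\<^sup>2) \<le> \<Lambda> * (\<Sum>(u, v)\<in>A. (mdist ?P (f u) (f v))\<^sup>2)"
    by (simp add: sum.cartesian_product case_prod_unfold sum_distrib_left)
qed

end

lemma poincare_isometric:
  assumes iso: "isometric_spaces X Y" and P: "poincare_inequality V w A \<Lambda> Y" and A: "A \<subseteq> V \<times> V"
  shows "poincare_inequality V w A \<Lambda> X"
  unfolding poincare_inequality_def
proof
  obtain h where h: "h ` mspace X = mspace Y"
    and hd: "\<And>x y. x \<in> mspace X \<Longrightarrow> y \<in> mspace X \<Longrightarrow> mdist Y (h x) (h y) = mdist X x y"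
    using iso unfolding isometric_spaces_def by blast
  fix f assume f: "f \<in> V \<rightarrow> mspace X"
  then have "h \<circ> f \<in> V \<rightarrow> mspace Y" using h by (auto simp: Pi_iff)
  from P[unfolded poincare_inequality_def, rule_format, OF this]
  have "(\<Sum>u\<in>V. \<Sum>v\<in>V. w u * w v * (mdist Y (h (f u)) (h (f v)))\<^sup>2)
      \<le> \<Lambda> * (\<Sum>(u, v)\<in>A. (mdist Y (h (f u)) (h (f v)))\<^sup>2)" by simp
  also have "(\<Sum>(u, v)\<in>A. (mdist Y (h (f u)) (h (f v)))\<^sup>2) = (\<Sum>(u, v)\<in>A. (mdist X (f u) (f v))\<^sup>2)"
    using A f by (intro sum.cong) (auto simp: hd Pi_iff)
  also have "(\<Sum>u\<in>V. \<Sum>v\<in>V. w u * w v * (mdist Y (h (f u)) (h (f v)))\<^sup>2) =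
      (\<Sum>u\<in>V. \<Sum>v\<in>V. w u * w v * (mdist X (f u) (f v))\<^sup>2)"
    using f by (intro sum.cong) (auto simp: hd Pi_iff)
  finally show "(\<Sum>u\<in>V. \<Sum>v\<in>V. w u * w v * (mdist X (f u) (f v))\<^sup>2)
      \<le> \<Lambda> * (\<Sum>(u, v)\<in>A. (mdist X (f u) (f v))\<^sup>2)" .
qed

lemma small_scale_covering_mono:
  assumes "small_scale_covering Y M" "M \<le> M'"
  shows "small_scale_covering Y M'"
proof -
  have "card C \<le> M \<Longrightarrow> card C \<le> M'" for C :: "'a set" using assms(2) by simp
  then show ?thesis using assms(1) unfolding small_scale_covering_def by meson
qed

section \<open>The spectral gap of a graph\<close>

lemma nonneg_quadratic_linear_coeff:
  fixes a b :: real
  assumes "\<And>t. 0 \<le> 2 * b * t + a * t\<^sup>2"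
  shows "b = 0"
proof (rule ccontr)
  assume b: "b \<noteq> 0"
  define k where "k = \<bar>a\<bar> + 1"
  have k: "a < k" "0 < k" by (auto simp: k_def)
  have "0 \<le> 2 * b * (- b / k) + a * (- b / k)\<^sup>2" by (rule assms)
  also have "\<dots> = - (b\<^sup>2 / k) * (2 - a / k)"
    using k by (simp add: field_simps power2_eq_square)
  also have "\<dots> < 0"
    using b k by (intro mult_neg_pos) (auto simp: field_simps)
  finally show False by simp
qed

text \<open>
  Compactness of the unit sphere among the functions of mean zero; by homogeneity the minimum
  controls all functions of mean zero.  Total functions are cut down to \<open>V\<close> in order to work in
  the product topology.
\<close>

lemma rayleigh_minimizer:
  fixes m :: "'v \<Rightarrow> real" and A :: "('v \<times> 'v) set"
  assumes V: "finite V" and A: "A \<subseteq> V \<times> V" and m: "\<And>v. v \<in> V \<Longrightarrow> 1 \<le> m v" and two: "2 \<le> card V"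
  obtains g where "(\<Sum>v\<in>V. m v * g v) = 0" "(\<Sum>v\<in>V. m v * (g v)\<^sup>2) = 1"
    "\<forall>h. (\<Sum>v\<in>V. m v * h v) = 0 \<longrightarrow>
      (\<Sum>(u, v)\<in>A. (g u - g v)\<^sup>2) * (\<Sum>v\<in>V. m v * (h v)\<^sup>2) \<le> (\<Sum>(u, v)\<in>A. (h u - h v)\<^sup>2)"
proof -
  have m0: "0 \<le> m v" if "v \<in> V" for v using m[OF that] by simp
  define T where "T = product_topology (\<lambda>_. euclideanreal) V"
  define l where "l h = (\<Sum>v\<in>V. m v * h v)" for h :: "'v \<Rightarrow> real"
  define q where "q h = (\<Sum>v\<in>V. m v * (h v)\<^sup>2)" for h :: "'v \<Rightarrow> real"
  define D where "D h = (\<Sum>(u, v)\<in>A. (h u - h v)\<^sup>2)" for h :: "'v \<Rightarrow> real"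
  have fA: "finite A" using V A by (meson finite_SigmaI finite_subset)
  have proj: "continuous_map T euclideanreal (\<lambda>h. h v)" if "v \<in> V" for v
    unfolding T_def using that by (rule continuous_map_product_projection)
  have cl: "continuous_map T euclideanreal l"
    unfolding l_def by (intro continuous_map_sum V continuous_map_real_mult proj) auto
  have cq: "continuous_map T euclideanreal q"
    unfolding q_def by (intro continuous_map_sum V continuous_map_real_mult continuous_map_real_pow proj) auto
  have cD: "continuous_map T euclideanreal D"
    unfolding D_def case_prod_unfold
    using A by (intro continuous_map_sum fA continuous_map_real_pow continuous_map_diff proj) auto
  define S where "S = {h \<in> topspace T. l h \<in> {0}} \<inter> ({h \<in> topspace T. q h \<in> {1}} \<inter> PiE V (\<lambda>_. {-1..1}))"
  have "compactin T (PiE V (\<lambda>_. {-1..1}))"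
    unfolding T_def compactin_PiE by simp
  then have S: "compactin T S"
    unfolding S_def
    by (intro closed_Int_compactin closedin_continuous_map_preimage[OF cl] closedin_continuous_map_preimage[OF cq]) auto
  have normal: "restrict h V \<in> S" if "l h = 0" "q h = 1" for h
  proof -
    have "h v \<in> {-1..1}" if v: "v \<in> V" for v
    proof -
      have "m v * (h v)\<^sup>2 \<le> q h"
        unfolding q_def using v V m0 by (intro member_le_sum) auto
      moreover have "1 * (h v)\<^sup>2 \<le> m v * (h v)\<^sup>2" using m[OF v] by (intro mult_right_mono) auto
      ultimately have "(h v)\<^sup>2 \<le> 1" using \<open>q h = 1\<close> by simp
      then show ?thesis by (simp add: abs_square_le_1 abs_le_iff)
    qed
    moreover have "l (restrict h V) = l h" "q (restrict h V) = q h" by (auto simp: l_def q_def)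
    ultimately show ?thesis using that by (auto simp: S_def T_def)
  qed
  obtain a b where ab: "a \<in> V" "b \<in> V" "a \<noteq> b" using two V by (auto simp: card_le_Suc_iff numeral_2_eq_2)
  \<comment> \<open>A nonzero function of mean zero, which shows that the set is nonempty.\<close>
  define h0 where "h0 = (\<lambda>v. if v = a then m b else if v = b then - m a else 0)"
  have mab: "1 \<le> m a" "1 \<le> m b" using ab m by auto
  have "l h0 = (\<Sum>v\<in>{a, b}. m v * h0 v)"
    unfolding l_def using V ab by (intro sum.mono_neutral_right) (auto simp: h0_def)
  then have l0: "l h0 = 0" using ab by (simp add: h0_def)
  have q0: "0 < q h0"
    unfolding q_def using V ab mab m0 by (intro sum_pos2[where i = a]) (auto simp: h0_def)
  have scale: "l (\<lambda>v. c * h v) = c * l h" "q (\<lambda>v. c * h v) = c\<^sup>2 * q h" "D (\<lambda>v. c * h v) = c\<^sup>2 * D h" for c h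
    by (auto simp: l_def q_def D_def sum_distrib_left power_mult_distrib right_diff_distrib[symmetric] case_prod_unfold mult_ac
        intro!: sum.cong)
  have unit: "l (\<lambda>v. 1 / sqrt (q h) * h v) = 0 \<and> q (\<lambda>v. 1 / sqrt (q h) * h v) = 1" if "l h = 0" "0 < q h" for h
    unfolding scale using that by (simp add: power_divide)
  have "S \<noteq> {}" using normal unit[OF l0 q0] by blast
  moreover have "compact (D ` S)" using image_compactin[OF S cD] by simp
  ultimately obtain g where g: "g \<in> S" "\<And>h. h \<in> S \<Longrightarrow> D g \<le> D h"
    using compact_attains_inf[of "D ` S"] by blast
  have lg: "l g = 0" "q g = 1" using g by (auto simp: S_def)
  have "D g * q h \<le> D h" if h: "l h = 0" for h
  proof (cases "q h = 0")
    case True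
    then show ?thesis by (simp add: D_def sum_nonneg case_prod_unfold)
  next
    case False
    have "0 \<le> q h" unfolding q_def using m0 by (intro sum_nonneg mult_nonneg_nonneg) auto
    with False have pos: "0 < q h" by simp
    let ?h = "\<lambda>v. 1 / sqrt (q h) * h v"
    have "D g \<le> D (restrict ?h V)" using normal unit[OF h pos] g(2) by blast
    also have "D (restrict ?h V) = D ?h" using A by (auto simp: D_def intro!: sum.cong)
    also have "\<dots> = D h / q h" unfolding scale using pos by (simp add: power_divide)
    finally show ?thesis using pos by (simp add: field_simps)
  qed
  then show thesis using that[of g] lg unfolding l_def q_def D_def by blast
qed

locale fin_conn_graph =
  fixes V :: "'v set" and E :: "'v set set"
  assumes graph: "finite_connected_graph V E"
begin

lemma finite_V: "finite V" and card_V: "2 \<le> card V"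
  and edge_mem: "{u, v} \<in> E \<Longrightarrow> u \<in> V \<and> v \<in> V \<and> u \<noteq> v"
  and connected: "u \<in> V \<Longrightarrow> v \<in> V \<Longrightarrow> (u, v) \<in> (adj E)\<^sup>*"
  using graph unfolding finite_connected_graph_def by (fastforce simp: doubleton_eq_iff)+

lemma adj_iff: "(u, v) \<in> adj E \<longleftrightarrow> {u, v} \<in> E"
  by (simp add: adj_def)

lemma adj_subset: "adj E \<subseteq> V \<times> V"
  using edge_mem by (auto simp: adj_iff)

lemma finite_adj: "finite (adj E)"
  using adj_subset finite_V by (meson finite_SigmaI finite_subset)

lemma sum_adj: "(\<Sum>(u, v)\<in>adj E. k u v) = (\<Sum>v\<in>V. \<Sum>u | {u, v} \<in> E. k v u)"
proof -
  have "adj E = (SIGMA v:V. {u. {u, v} \<in> E})"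
    using edge_mem by (auto simp: adj_iff insert_commute)
  moreover have "finite {u. {u, v} \<in> E}" for v
    using edge_mem by (intro finite_subset[OF _ finite_V]) auto
  ultimately show ?thesis using finite_V by (simp add: sum.Sigma)
qed

lemma sum_adj_swap: "(\<Sum>(u, v)\<in>adj E. k u v) = (\<Sum>(u, v)\<in>adj E. k v u)"
  by (rule sum.reindex_bij_witness[of _ prod.swap prod.swap]) (auto simp: adj_iff insert_commute)

lemma deg_pos:
  assumes v: "v \<in> V"
  shows "1 \<le> deg E v"
proof -
  obtain u where u: "u \<in> V" "u \<noteq> v"
    using card_V v finite_V by (metis card_le_Suc0_iff_eq not_less_eq_eq numeral_2_eq_2)
  have "\<exists>x. (v, x) \<in> adj E"
    using connected[OF v u(1)] u(2) by (auto elim: converse_rtranclE)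
  then have "{u. {u, v} \<in> E} \<noteq> {}" by (auto simp: adj_iff insert_commute)
  moreover have "finite {u. {u, v} \<in> E}"
    using edge_mem by (intro finite_subset[OF _ finite_V]) auto
  ultimately show ?thesis unfolding deg_def by (simp add: Suc_le_eq card_gt_0_iff)
qed

lemma sum_deg: "(\<Sum>v\<in>V. real (deg E v)) = real (card (adj E))"
  using sum_adj[of "\<lambda>_ _. 1 :: real"] by (simp add: deg_def)

lemma deg_laplacian:
  assumes "v \<in> V"
  shows "real (deg E v) * laplacian E f v = (\<Sum>u | {u, v} \<in> E. f v - f u)"
  using deg_pos[OF assms] by (simp add: laplacian_def right_diff_distrib sum_subtractf) (simp add: deg_def)

text \<open>
  Summation by parts.  The factor 2 reflects that \<open>adj E\<close> contains both orientations of an edge.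
\<close>

lemma Green: "2 * (\<Sum>v\<in>V. real (deg E v) * laplacian E f v * h v) = (\<Sum>(u, v)\<in>adj E. (f u - f v) * (h u - h v))"
proof -
  have "(\<Sum>v\<in>V. real (deg E v) * laplacian E f v * h v) = (\<Sum>v\<in>V. \<Sum>u | {u, v} \<in> E. (f v - f u) * h v)"
    by (intro sum.cong refl) (simp add: deg_laplacian sum_distrib_right)
  then have 1: "(\<Sum>v\<in>V. real (deg E v) * laplacian E f v * h v) = (\<Sum>(u, v)\<in>adj E. (f u - f v) * h u)"
    by (simp add: sum_adj)
  also have "\<dots> = (\<Sum>(u, v)\<in>adj E. (f v - f u) * h v)"
    by (rule sum_adj_swap)
  finally have 2: "(\<Sum>v\<in>V. real (deg E v) * laplacian E f v * h v) = (\<Sum>(u, v)\<in>adj E. (f v - f u) * h v)" .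
  have "2 * (\<Sum>v\<in>V. real (deg E v) * laplacian E f v * h v) =
      (\<Sum>(u, v)\<in>adj E. (f u - f v) * h u) + (\<Sum>(u, v)\<in>adj E. (f v - f u) * h v)"
    using 1 2 by simp
  also have "\<dots> = (\<Sum>(u, v)\<in>adj E. (f u - f v) * (h u - h v))"
    unfolding sum.distrib[symmetric] by (intro sum.cong) (auto simp: algebra_simps)
  finally show ?thesis .
qed

lemma dirichlet_zero_imp_constant:
  assumes "(\<Sum>(u, v)\<in>adj E. (g u - g v)\<^sup>2) = (0::real)" "u \<in> V" "v \<in> V"
  shows "g u = g v"
proof -
  have step: "g x = g y" if "(x, y) \<in> adj E" for x y
  proof -
    have "(\<lambda>(u, v). (g u - g v)\<^sup>2) (x, y) = 0"
      using assms(1) finite_adj that by (subst (asm) sum_nonneg_eq_0_iff) auto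
    then show ?thesis by simp
  qed
  from connected[OF assms(2,3)] show ?thesis
    by (induction rule: rtrancl_induct) (auto dest: step)
qed

text \<open>
  The minimum of the Rayleigh quotient is attained by an eigenfunction, and no positive eigenvalue
  is smaller, because eigenfunctions for nonzero eigenvalues have mean zero.  Hence the least
  positive eigenvalue exists and equals that minimum.
\<close>

lemma mu1_le_rayleigh:
  assumes mean: "(\<Sum>v\<in>V. real (deg E v) * h v) = 0"
  shows "2 * mu1 V E * (\<Sum>v\<in>V. real (deg E v) * (h v)\<^sup>2) \<le> (\<Sum>(u, v)\<in>adj E. (h u - h v)\<^sup>2)"
proof -
  let ?m = "\<lambda>v. real (deg E v)"
  let ?D = "\<lambda>h. \<Sum>(u, v)\<in>adj E. (h u - h v)\<^sup>2"
  have m1: "1 \<le> ?m v" if "v \<in> V" for v using deg_pos[OF that] by simp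
  obtain g where g: "(\<Sum>v\<in>V. ?m v * g v) = 0" "(\<Sum>v\<in>V. ?m v * (g v)\<^sup>2) = 1"
    and min': "\<forall>h. (\<Sum>v\<in>V. ?m v * h v) = 0 \<longrightarrow> ?D g * (\<Sum>v\<in>V. ?m v * (h v)\<^sup>2) \<le> ?D h"
    by (rule rayleigh_minimizer[OF finite_V adj_subset m1 card_V])
  have min: "?D g * (\<Sum>v\<in>V. ?m v * (h v)\<^sup>2) \<le> ?D h" if "(\<Sum>v\<in>V. ?m v * h v) = 0" for h
    using min' that by (elim allE impE)
  let ?r = "?D g"
  have r0: "0 \<le> ?r" by (intro sum_nonneg) auto
  have r_pos: "0 < ?r"
  proof (rule ccontr)
    assume "\<not> 0 < ?r"
    then have "?D g = 0" using r0 by simp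
    then have const: "g u = g v" if "u \<in> V" "v \<in> V" for u v
      using dirichlet_zero_imp_constant that by blast
    obtain x where x: "x \<in> V" using card_V by fastforce
    have "(\<Sum>v\<in>V. ?m v * (g v)\<^sup>2) = g x * (\<Sum>v\<in>V. ?m v * g v)"
      unfolding sum_distrib_left by (intro sum.cong) (auto simp: const[OF _ x] power2_eq_square)
    then show False using g by simp
  qed
  \<comment> \<open>First variation at the minimizer \<open>g\<close> in a direction \<open>h\<close> of mean zero.\<close>
  have orth: "(\<Sum>v\<in>V. ?m v * (laplacian E g v - ?r / 2 * g v) * h v) = 0" if h: "(\<Sum>v\<in>V. ?m v * h v) = 0" for h
  proof -
    let ?B = "\<Sum>(u, v)\<in>adj E. (g u - g v) * (h u - h v)"
    let ?b = "\<Sum>v\<in>V. ?m v * (g v * h v)"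
    have "0 \<le> 2 * (?B - ?r * ?b) * t + (?D h - ?r * (\<Sum>v\<in>V. ?m v * (h v)\<^sup>2)) * t\<^sup>2" for t
    proof -
      have "(\<Sum>v\<in>V. ?m v * (g v + t * h v)) = (\<Sum>v\<in>V. ?m v * g v) + t * (\<Sum>v\<in>V. ?m v * h v)"
        by (simp add: sum_distrib_left sum.distrib algebra_simps)
      then have "(\<Sum>v\<in>V. ?m v * (g v + t * h v)) = 0" using g h by simp
      from min[OF this] have "?r * (\<Sum>v\<in>V. ?m v * (g v + t * h v)\<^sup>2) \<le> ?D (\<lambda>v. g v + t * h v)" .
      moreover have "(\<Sum>v\<in>V. ?m v * (g v + t * h v)\<^sup>2) = 1 + 2 * t * ?b + t\<^sup>2 * (\<Sum>v\<in>V. ?m v * (h v)\<^sup>2)"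
        unfolding g(2)[symmetric] sum_distrib_left sum.distrib[symmetric]
        by (intro sum.cong) (auto simp: power2_eq_square algebra_simps)
      moreover have "?D (\<lambda>v. g v + t * h v) = ?r + 2 * t * ?B + t\<^sup>2 * ?D h"
        unfolding sum_distrib_left sum.distrib[symmetric]
        by (intro sum.cong) (auto simp: power2_eq_square algebra_simps)
      ultimately show ?thesis by (simp add: algebra_simps)
    qed
    then have "?B - ?r * ?b = 0" by (rule nonneg_quadratic_linear_coeff)
    then have "2 * (\<Sum>v\<in>V. ?m v * laplacian E g v * h v) = ?r * ?b" by (simp add: Green)
    moreover have "(\<Sum>v\<in>V. ?m v * (laplacian E g v - ?r / 2 * g v) * h v) =
        (\<Sum>v\<in>V. ?m v * laplacian E g v * h v) - ?r / 2 * ?b"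
      unfolding sum_distrib_left sum_subtractf[symmetric] by (intro sum.cong) (auto simp: algebra_simps)
    ultimately show ?thesis by simp
  qed
  have lap0: "(\<Sum>v\<in>V. ?m v * laplacian E f v) = 0" for f
    using Green[of f "\<lambda>_. 1"] by (simp add: case_prod_unfold)
  \<comment> \<open>The defect of the eigenvalue equation is itself an admissible direction.\<close>
  define \<psi> where "\<psi> v = laplacian E g v - ?r / 2 * g v" for v
  have "(\<Sum>v\<in>V. ?m v * \<psi> v) = (\<Sum>v\<in>V. ?m v * laplacian E g v) - ?r / 2 * (\<Sum>v\<in>V. ?m v * g v)"
    unfolding \<psi>_def sum_distrib_left sum_subtractf[symmetric] by (intro sum.cong) (auto simp: algebra_simps)
  then have "(\<Sum>v\<in>V. ?m v * \<psi> v * \<psi> v) = 0"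
    using orth[of \<psi>] lap0 g(1) unfolding \<psi>_def by simp
  then have "?m v * \<psi> v * \<psi> v = 0" if "v \<in> V" for v
    using that finite_V by (subst (asm) sum_nonneg_eq_0_iff) (auto simp: mult.assoc)
  then have \<psi>0: "\<psi> v = 0" if "v \<in> V" for v using that m1[OF that] by fastforce
  have eig: "laplacian_eigenvalue V E (?r / 2)"
    unfolding laplacian_eigenvalue_def
  proof (intro exI[of _ g] conjI ballI)
    show "\<exists>v\<in>V. g v \<noteq> 0" by (rule ccontr) (use g(2) in simp)
    show "laplacian E g v = ?r / 2 * g v" if "v \<in> V" for v using \<psi>0[OF that] by (simp add: \<psi>_def)
  qed
  have least: "?r / 2 \<le> c" if c: "0 < c" "laplacian_eigenvalue V E c" for c
  proof -
    obtain f where f: "\<exists>v\<in>V. f v \<noteq> 0" "\<And>v. v \<in> V \<Longrightarrow> laplacian E f v = c * f v"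
      using c unfolding laplacian_eigenvalue_def by blast
    have "c * (\<Sum>v\<in>V. ?m v * f v) = (\<Sum>v\<in>V. ?m v * laplacian E f v)"
      unfolding sum_distrib_left by (intro sum.cong) (auto simp: f)
    then have mean: "(\<Sum>v\<in>V. ?m v * f v) = 0" using lap0 c by simp
    have "?D f = 2 * (\<Sum>v\<in>V. ?m v * laplacian E f v * f v)"
      unfolding Green by (simp add: power2_eq_square)
    also have "\<dots> = 2 * c * (\<Sum>v\<in>V. ?m v * (f v)\<^sup>2)"
      unfolding sum_distrib_left by (intro sum.cong) (auto simp: f power2_eq_square)
    finally have "?r * (\<Sum>v\<in>V. ?m v * (f v)\<^sup>2) \<le> 2 * c * (\<Sum>v\<in>V. ?m v * (f v)\<^sup>2)"
      using min[OF mean] by simp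
    moreover have "0 < (\<Sum>v\<in>V. ?m v * (f v)\<^sup>2)"
    proof -
      obtain x where x: "x \<in> V" "f x \<noteq> 0" using f by blast
      then show ?thesis using finite_V m1[of x] by (intro sum_pos2[where i = x]) auto
    qed
    ultimately show ?thesis by simp
  qed
  have mu: "mu1 V E = ?r / 2"
    unfolding mu1_def using eig least r_pos by (intro Least_equality) auto
  have "2 * mu1 V E = ?r" unfolding mu by simp
  then show ?thesis using min[OF mean] by (simp only:)
qed

text \<open>
  The stationary distribution of the simple random walk; the denominator is the sum of all degrees.
\<close>

definition stationary :: "'v \<Rightarrow> real" where
  "stationary v = real (deg E v) / real (card (adj E))"

lemma card_adj_pos: "0 < real (card (adj E))"
proof -
  have "V \<noteq> {}" using card_V by auto
  then have "0 < (\<Sum>v\<in>V. real (deg E v))"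
    using deg_pos finite_V by (intro sum_pos) (auto simp: Suc_le_eq)
  then show ?thesis by (simp only: sum_deg)
qed

lemma sum_stationary: "sum stationary V = 1"
  using card_adj_pos by (simp add: stationary_def sum_divide_distrib[symmetric] sum_deg)

lemma poincare_real:
  assumes c: "0 < c" "c \<le> mu1 V E"
  shows "poincare_inequality V stationary (adj E) (1 / (c * real (card (adj E)))) (euclidean_metric :: real metric)"
  unfolding poincare_inequality_def
proof
  let ?m = "\<lambda>v. real (deg E v)" and ?W = "real (card (adj E))"
  fix g :: "'v \<Rightarrow> real"
  let ?D = "\<Sum>(u, v)\<in>adj E. (g u - g v)\<^sup>2"
  define a where "a = (\<Sum>v\<in>V. stationary v * g v)"
  define h where "h v = g v - a" for v
  have h0: "(\<Sum>v\<in>V. stationary v * h v) = 0"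
  proof -
    have "(\<Sum>v\<in>V. stationary v * h v) = a - sum stationary V * a"
      unfolding a_def h_def right_diff_distrib sum_subtractf sum_distrib_right ..
    then show ?thesis by (simp add: sum_stationary)
  qed
  have conv: "(\<Sum>v\<in>V. stationary v * k v) = (\<Sum>v\<in>V. ?m v * k v) / ?W" for k
    by (simp add: stationary_def sum_divide_distrib)
  have mh0: "(\<Sum>v\<in>V. ?m v * h v) = 0" using h0 card_adj_pos by (simp add: conv)
  have S0: "0 \<le> (\<Sum>v\<in>V. ?m v * (h v)\<^sup>2)" by (intro sum_nonneg) auto
  have "(\<Sum>u\<in>V. \<Sum>v\<in>V. stationary u * stationary v * (g u - g v)\<^sup>2) =
     (\<Sum>u\<in>V. \<Sum>v\<in>V. stationary v * (stationary u * (h u)\<^sup>2) + stationary u * (stationary v * (h v)\<^sup>2)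
        - 2 * (stationary u * h u) * (stationary v * h v))"
    by (intro sum.cong) (auto simp: h_def power2_eq_square algebra_simps)
  also have "\<dots> = (\<Sum>u\<in>V. sum stationary V * (stationary u * (h u)\<^sup>2) + stationary u * (\<Sum>v\<in>V. stationary v * (h v)\<^sup>2)
        - 2 * (stationary u * h u) * (\<Sum>v\<in>V. stationary v * h v))"
    unfolding sum.distrib sum_subtractf sum_distrib_left sum_distrib_right ..
  also have "\<dots> = 2 * (\<Sum>v\<in>V. stationary v * (h v)\<^sup>2)"
    unfolding h0 sum_stationary by (simp add: sum.distrib sum_distrib_right[symmetric] sum_stationary)
  also have "\<dots> = 2 * (\<Sum>v\<in>V. ?m v * (h v)\<^sup>2) / ?W" by (simp add: conv)
  also have "\<dots> \<le> 1 / (c * ?W) * ?D"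
  proof -
    have "2 * c * (\<Sum>v\<in>V. ?m v * (h v)\<^sup>2) \<le> 2 * mu1 V E * (\<Sum>v\<in>V. ?m v * (h v)\<^sup>2)"
      using c S0 by (intro mult_right_mono) auto
    also have "\<dots> \<le> (\<Sum>(u, v)\<in>adj E. (h u - h v)\<^sup>2)" by (rule mu1_le_rayleigh[OF mh0])
    also have "\<dots> = ?D" by (simp add: h_def)
    finally show ?thesis using c card_adj_pos by (simp add: field_simps)
  qed
  finally show "(\<Sum>u\<in>V. \<Sum>v\<in>V. stationary u * stationary v * (mdist euclidean_metric (g u) (g v))\<^sup>2)
      \<le> 1 / (c * ?W) * (\<Sum>(u, v)\<in>adj E. (mdist euclidean_metric (g u) (g v))\<^sup>2)"
    by (simp add: dist_real_def)
qed

lemma graph_dist_relpow: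
  assumes "u \<in> V" "v \<in> V"
  shows "(u, v) \<in> adj E ^^ graph_dist E u v"
proof -
  have "\<exists>n. (u, v) \<in> adj E ^^ n" using connected[OF assms] by (simp only: rtrancl_power)
  then show ?thesis unfolding graph_dist_def by (rule LeastI_ex)
qed

lemma graph_dist_edge: "(u, v) \<in> adj E \<Longrightarrow> graph_dist E u v \<le> 1"
  unfolding graph_dist_def by (rule Least_le) simp

lemma card_ball_le:
  assumes d: "\<And>v. v \<in> V \<Longrightarrow> deg E v \<le> d" and u: "u \<in> V"
  shows "card {v \<in> V. graph_dist E u v \<le> R} \<le> (d + 1) ^ R"
proof -
  define S where "S n = {v. \<exists>k\<le>n. (u, v) \<in> adj E ^^ k}" for n
  have SV: "S n \<subseteq> V" for n
  proof
    fix v assume "v \<in> S n"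
    then have "(u, v) \<in> (adj E)\<^sup>*" unfolding S_def by (auto intro: relpow_imp_rtrancl)
    then show "v \<in> V" using u adj_subset by (induction rule: rtrancl_induct) auto
  qed
  have "card (S n) \<le> (d + 1) ^ n" for n
  proof (induction n)
    case 0
    have "S 0 = {u}" by (auto simp: S_def)
    then show ?case by simp
  next
    case (Suc n)
    have fin: "finite (S n)" using SV finite_V finite_subset by blast
    have "S (Suc n) \<subseteq> S n \<union> (\<Union>x\<in>S n. {y. {y, x} \<in> E})"
    proof
      fix v assume "v \<in> S (Suc n)"
      then obtain k where k: "k \<le> Suc n" "(u, v) \<in> adj E ^^ k" by (auto simp: S_def)
      show "v \<in> S n \<union> (\<Union>x\<in>S n. {y. {y, x} \<in> E})"
      proof (cases "k \<le> n")
        case True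
        then show ?thesis using k by (auto simp: S_def)
      next
        case False
        then have "k = Suc n" using k by simp
        then obtain x where "(u, x) \<in> adj E ^^ n" "(x, v) \<in> adj E" using k(2) by auto
        then show ?thesis by (auto simp: S_def adj_iff insert_commute)
      qed
    qed
    then have "card (S (Suc n)) \<le> card (S n \<union> (\<Union>x\<in>S n. {y. {y, x} \<in> E}))"
      using SV edge_mem by (intro card_mono finite_subset[OF _ finite_V]) auto
    also have "\<dots> \<le> card (S n) + (\<Sum>x\<in>S n. card {y. {y, x} \<in> E})"
      by (rule order_trans[OF card_Un_le add_left_mono[OF card_UN_le[OF fin]]])
    also have "\<dots> \<le> card (S n) + (\<Sum>x\<in>S n. d)"
      using d SV by (intro add_left_mono sum_mono) (auto simp: deg_def)
    also have "\<dots> = (d + 1) * card (S n)" by simp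
    also have "\<dots> \<le> (d + 1) ^ Suc n" using mult_left_mono[OF Suc, of "d + 1"] by simp
    finally show ?case .
  qed
  moreover have "{v \<in> V. graph_dist E u v \<le> R} \<subseteq> S R"
    using graph_dist_relpow[OF u] by (auto simp: S_def)
  then have "card {v \<in> V. graph_dist E u v \<le> R} \<le> card (S R)"
    by (intro card_mono finite_subset[OF SV finite_V])
  ultimately show ?thesis by (rule order_trans[rotated])
qed

end

section \<open>Expanders and coarse embeddings\<close>

context fin_conn_graph
begin

text \<open>
  In a large graph of bounded degree at least half of all pairs are farther apart than \<open>R\<close>, and the
  stationary weight of a vertex is at least \<open>1 / d\<close> times its uniform weight.
\<close>

lemma far_pairs_average:
  fixes d :: nat
  assumes d: "\<And>v. v \<in> V \<Longrightarrow> deg E v \<le> d" and large: "2 * (d + 1) ^ R \<le> card V"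
    and k: "\<And>u v. u \<in> V \<Longrightarrow> v \<in> V \<Longrightarrow> 0 \<le> k u v" and a: "0 \<le> a"
    and far: "\<And>u v. u \<in> V \<Longrightarrow> v \<in> V \<Longrightarrow> R < graph_dist E u v \<Longrightarrow> a \<le> k u v"
  shows "a \<le> 2 * (real d)\<^sup>2 * (\<Sum>u\<in>V. \<Sum>v\<in>V. stationary u * stationary v * k u v)"
proof -
  let ?n = "real (card V)"
  have n: "0 < ?n" using card_V by simp
  have d0: "0 < real d"
  proof -
    obtain x where "x \<in> V" using card_V by fastforce
    then show ?thesis using d[of x] deg_pos[of x] by simp
  qed
  have W: "real (card (adj E)) \<le> real d * ?n"
  proof -
    have "(\<Sum>v\<in>V. real (deg E v)) \<le> (\<Sum>v\<in>V. real d)" using d by (intro sum_mono) simp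
    then show ?thesis by (simp add: sum_deg mult.commute)
  qed
  have st: "1 / (real d * ?n) \<le> stationary v" if "v \<in> V" for v
    unfolding stationary_def using deg_pos[OF that] W card_adj_pos by (intro frac_le) auto
  have q0: "0 \<le> 1 / (real d * ?n)" using n d0 by simp
  define q where "q = (1 / (real d * ?n))\<^sup>2"
  have q: "q \<le> stationary u * stationary v" if "u \<in> V" "v \<in> V" for u v
    unfolding q_def power2_eq_square using st that q0 by (intro mult_mono) (auto intro: order_trans[OF q0])
  have "(\<Sum>u\<in>V. ?n / 2 * (q * a)) \<le> (\<Sum>u\<in>V. \<Sum>v\<in>V. stationary u * stationary v * k u v)"
  proof (rule sum_mono)
    fix u assume u: "u \<in> V"
    let ?B = "{v \<in> V. graph_dist E u v \<le> R}"
    have "card ?B \<le> (d + 1) ^ R" by (rule card_ball_le[OF d u])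
    then have "2 * card ?B \<le> card V" using large by linarith
    moreover have "card (V - ?B) = card V - card ?B" using finite_V by (intro card_Diff_subset) auto
    ultimately have "?n / 2 \<le> real (card (V - ?B))" by linarith
    moreover have "0 \<le> q * a" using a by (simp add: q_def)
    ultimately have "?n / 2 * (q * a) \<le> real (card (V - ?B)) * (q * a)" by (rule mult_right_mono)
    also have "\<dots> = (\<Sum>v\<in>V - ?B. q * a)" by simp
    also have "\<dots> \<le> (\<Sum>v\<in>V - ?B. stationary u * stationary v * k u v)"
      using q far a u by (intro sum_mono mult_mono) (auto intro: order_trans[of 0 q] simp: q_def stationary_def)
    also have "\<dots> \<le> (\<Sum>v\<in>V. stationary u * stationary v * k u v)"
      using finite_V k u by (intro sum_mono2) (auto simp: stationary_def)
    finally show "?n / 2 * (q * a) \<le> (\<Sum>v\<in>V. stationary u * stationary v * k u v)" .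
  qed
  moreover have "(\<Sum>u\<in>V. ?n / 2 * (q * a)) = a / (2 * (real d)\<^sup>2)"
    using n d0 by (simp add: q_def power2_eq_square)
  ultimately have "a / (2 * (real d)\<^sup>2) \<le> (\<Sum>u\<in>V. \<Sum>v\<in>V. stationary u * stationary v * k u v)"
    by linarith
  moreover have "0 < 2 * (real d)\<^sup>2" using d0 by simp
  ultimately show ?thesis by (simp only: pos_divide_le_eq mult.commute)
qed

text \<open>
  The number of ordered edges cancels against the denominator in the Poincare constant, so the
  average squared distance is bounded independently of the size of the graph.
\<close>

lemma poincare_coarse_bound:
  fixes X :: "'a metric"
  assumes c: "0 < c" "c \<le> mu1 V E" and C: "0 \<le> C"
    and P: "poincare_inequality V stationary (adj E) (C * (1 / (c * real (card (adj E))))) X"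
    and f: "f \<in> V \<rightarrow> mspace X" and edge: "\<And>u v. (u, v) \<in> adj E \<Longrightarrow> mdist X (f u) (f v) \<le> B"
  shows "(\<Sum>u\<in>V. \<Sum>v\<in>V. stationary u * stationary v * (mdist X (f u) (f v))\<^sup>2) \<le> C * B\<^sup>2 / c"
proof -
  let ?W = "real (card (adj E))"
  have "(\<Sum>u\<in>V. \<Sum>v\<in>V. stationary u * stationary v * (mdist X (f u) (f v))\<^sup>2)
      \<le> C * (1 / (c * ?W)) * (\<Sum>(u, v)\<in>adj E. (mdist X (f u) (f v))\<^sup>2)"
    using P[unfolded poincare_inequality_def] f by blast
  also have "\<dots> \<le> C * (1 / (c * ?W)) * (\<Sum>(u, v)\<in>adj E. B\<^sup>2)"
    using edge C c by (intro mult_left_mono sum_mono) (auto intro!: power_mono mdist_nonneg_of)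
  also have "\<dots> = C * B\<^sup>2 / c" using c card_adj_pos by (simp add: case_prod_unfold)
  finally show ?thesis .
qed

end

text \<open>
  The average squared distance between images is bounded along the sequence, since edges have
  bounded length; but most pairs of vertices are far apart in the graph, hence in \<open>X\<close>.
\<close>

theorem no_coarse_embedding_of_expanders:
  fixes X :: "'a metric" and V :: "nat \<Rightarrow> 'v set"
  assumes C: "0 \<le> C"
    and P: "\<And>(V :: 'v set) w A \<Lambda>. \<lbrakk>finite V; \<And>v. v \<in> V \<Longrightarrow> 0 \<le> w v; sum w V = 1; A \<subseteq> V \<times> V; 0 \<le> \<Lambda>;
        poincare_inequality V w A \<Lambda> (euclidean_metric :: real metric)\<rbrakk> \<Longrightarrow> poincare_inequality V w A (C * \<Lambda>) X"
    and ex: "expander_sequence L V E"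
  shows "\<not> embeds_coarsely L V E X"
proof
  assume "embeds_coarsely L V E X"
  then obtain \<alpha> \<beta> f where \<alpha>: "unbounded_nondecreasing \<alpha>" and \<beta>: "unbounded_nondecreasing \<beta>"
    and emb: "\<forall>l\<in>L. f l \<in> V l \<rightarrow> mspace X \<and> (\<forall>u\<in>V l. \<forall>v\<in>V l.
        \<alpha> (real (graph_dist (E l) u v)) \<le> mdist X (f l u) (f l v) \<and>
        mdist X (f l u) (f l v) \<le> \<beta> (real (graph_dist (E l) u v)))"
    unfolding embeds_coarsely_def by (elim exE conjE)
  have f: "f l \<in> V l \<rightarrow> mspace X" if "l \<in> L" for l
    using emb that by simp
  have lower: "\<alpha> (real (graph_dist (E l) u v)) \<le> mdist X (f l u) (f l v)"
    and upper: "mdist X (f l u) (f l v) \<le> \<beta> (real (graph_dist (E l) u v))"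
    if "l \<in> L" "u \<in> V l" "v \<in> V l" for l u v
    using emb that by simp_all
  have L: "infinite L" and graph: "\<And>l. l \<in> L \<Longrightarrow> finite_connected_graph (V l) (E l)"
    and grow: "filterlim (\<lambda>l. card (V l)) at_top (inf sequentially (principal L))"
    using ex by (auto simp: expander_sequence_def)
  obtain d where d: "\<And>l u. l \<in> L \<Longrightarrow> u \<in> V l \<Longrightarrow> deg (E l) u \<le> d"
    using ex by (auto simp: expander_sequence_def)
  obtain c where c: "0 < c" "\<And>l. l \<in> L \<Longrightarrow> c \<le> mu1 (V l) (E l)"
    using ex by (auto simp: expander_sequence_def)
  define K where "K = C * (\<beta> 1)\<^sup>2 / c"
  have K: "0 \<le> K" using C c by (simp add: K_def)
  have "\<not> bdd_above (\<alpha> ` {0..})" using \<alpha> by (simp add: unbounded_nondecreasing_def)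
  then have "\<exists>x\<ge>0. sqrt (2 * (real d)\<^sup>2 * K) < \<alpha> x"
    unfolding bdd_above_def by (metis (no_types, lifting) atLeast_iff imageE not_le)
  then obtain x where x: "0 \<le> x" "sqrt (2 * (real d)\<^sup>2 * K) < \<alpha> x" by blast
  define R where "R = nat \<lceil>x\<rceil>"
  have Rx: "x \<le> real R" unfolding R_def by linarith
  have "\<forall>\<^sub>F l in inf sequentially (principal L). 2 * (d + 1) ^ R \<le> card (V l)"
    using grow by (simp add: filterlim_at_top)
  then obtain N where N: "\<And>l. N \<le> l \<Longrightarrow> l \<in> L \<Longrightarrow> 2 * (d + 1) ^ R \<le> card (V l)"
    by (auto simp: eventually_inf_principal eventually_sequentially)
  obtain l where l: "l \<in> L" "N \<le> l" using L by (meson infinite_nat_iff_unbounded_le)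
  interpret G: fin_conn_graph "V l" "E l" by unfold_locales (rule graph[OF l(1)])
  let ?s = "\<lambda>u v. mdist X (f l u) (f l v)"
  have "poincare_inequality (V l) G.stationary (adj (E l)) (C * (1 / (c * real (card (adj (E l)))))) X"
  proof (rule P[OF G.finite_V _ G.sum_stationary G.adj_subset])
    show "poincare_inequality (V l) G.stationary (adj (E l)) (1 / (c * real (card (adj (E l))))) (euclidean_metric :: real metric)"
      using c l by (intro G.poincare_real)
  qed (use c in \<open>auto simp: G.stationary_def\<close>)
  then have "(\<Sum>u\<in>V l. \<Sum>v\<in>V l. G.stationary u * G.stationary v * (?s u v)\<^sup>2) \<le> K"
    unfolding K_def
  proof (rule G.poincare_coarse_bound[OF c(1) c(2)[OF l(1)] C _ f[OF l(1)]])
    fix u v assume uv: "(u, v) \<in> adj (E l)"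
    then have mem: "u \<in> V l" "v \<in> V l" using G.adj_subset by auto
    have "?s u v \<le> \<beta> (real (graph_dist (E l) u v))" by (rule upper[OF l(1) mem])
    also have "\<dots> \<le> \<beta> 1"
      using \<beta> G.graph_dist_edge[OF uv] unfolding unbounded_nondecreasing_def by (auto intro: mono_onD)
    finally show "?s u v \<le> \<beta> 1" .
  qed
  moreover have "(\<alpha> x)\<^sup>2 \<le> 2 * (real d)\<^sup>2 * (\<Sum>u\<in>V l. \<Sum>v\<in>V l. G.stationary u * G.stationary v * (?s u v)\<^sup>2)"
  proof (rule G.far_pairs_average[OF d[OF l(1)] N[OF l(2,1)]])
    fix u v assume uv: "u \<in> V l" "v \<in> V l" "R < graph_dist (E l) u v"
    have "0 \<le> \<alpha> x" using \<alpha> x(1) by (auto simp: unbounded_nondecreasing_def)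
    moreover have "\<alpha> x \<le> \<alpha> (real (graph_dist (E l) u v))"
      using \<alpha> x(1) Rx uv(3) unfolding unbounded_nondecreasing_def by (auto intro!: mono_onD[of "{0..}" \<alpha>])
    ultimately show "(\<alpha> x)\<^sup>2 \<le> (?s u v)\<^sup>2"
      using lower[OF l(1) uv(1,2)] by (intro power_mono) auto
  qed auto
  ultimately have "(\<alpha> x)\<^sup>2 \<le> 2 * (real d)\<^sup>2 * K"
    by (meson mult_left_mono order_trans zero_le_mult_iff zero_le_numeral zero_le_power2)
  then have "\<alpha> x \<le> sqrt (2 * (real d)\<^sup>2 * K)" by (rule real_le_rsqrt)
  then show False using x(2) by simp
qed

theorem theorem6p6:
  fixes X :: "'x metric"
    and I :: "nat set" and F :: "nat \<Rightarrow> 'a metric" and p :: "nat \<Rightarrow> 'a"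
  assumes "nondegenerate X" and "mcomplete_of X" and "CAT0 X"
    and "\<And>i. i \<in> I \<Longrightarrow> nondegenerate (F i)"
    and "\<And>i. i \<in> I \<Longrightarrow> p i \<in> mspace (F i)"
    and "isometric_spaces X (l2_product I F p)"
    and "(\<exists>\<Y> :: 'a metric set. finite \<Y> \<and>
            (\<forall>i \<in> I. \<exists>Y \<in> \<Y>. isometric_spaces (F i) Y) \<and>
            (\<forall>Y \<in> \<Y>. nondegenerate Y \<and> geodesically_complete Y \<and>
               (\<exists>(\<Gamma> :: 'g monoid) \<phi>. isometric_action \<Gamma> Y \<phi> \<and>
                  cocompact_action \<Gamma> Y \<phi> \<and> proper_action \<Gamma> Y \<phi>)))
         \<or> (\<exists>N \<ge> 1. \<forall>i \<in> I. CAT0 (F i) \<and> uniformly_locally_doubling (F i) N)"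
  shows "\<not> (\<exists>L (V :: nat \<Rightarrow> 'v set) E. expander_sequence L V E \<and> embeds_coarsely L V E X)"
proof -
  note pI = assms(5) and iso = assms(6)
  have CF: "CAT0 (F i)" and compF: "mcomplete_of (F i)" if "i \<in> I" for i
    using l2_product_factor_CAT0[OF pI that isometric_CAT0[OF iso assms(3)]]
      l2_product_factor_mcomplete[OF pI that isometric_mcomplete[OF iso assms(2)]] by auto
  \<comment> \<open>Under both conditions the factors are isometric to spaces with a common covering number.\<close>
  have model: "\<exists>M. \<forall>i\<in>I. \<exists>Y :: 'a metric. isometric_spaces (F i) Y \<and> small_scale_covering Y M"
    using assms(7)
  proof
    assume "\<exists>\<Y> :: 'a metric set. finite \<Y> \<and>
            (\<forall>i \<in> I. \<exists>Y \<in> \<Y>. isometric_spaces (F i) Y) \<and>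
            (\<forall>Y \<in> \<Y>. nondegenerate Y \<and> geodesically_complete Y \<and>
               (\<exists>(\<Gamma> :: 'g monoid) \<phi>. isometric_action \<Gamma> Y \<phi> \<and>
                  cocompact_action \<Gamma> Y \<phi> \<and> proper_action \<Gamma> Y \<phi>))"
    then obtain \<Y> :: "'a metric set" where fin: "finite \<Y>"
      and FY: "\<forall>i\<in>I. \<exists>Y \<in> \<Y>. isometric_spaces (F i) Y"
      and Y: "\<forall>Y\<in>\<Y>. nondegenerate Y \<and> geodesically_complete Y \<and>
         (\<exists>(\<Gamma> :: 'g monoid) \<phi>. isometric_action \<Gamma> Y \<phi> \<and> cocompact_action \<Gamma> Y \<phi> \<and> proper_action \<Gamma> Y \<phi>)"
      by (elim exE conjE)
    have "\<forall>Y\<in>\<Y>. \<exists>M. CAT0 Y \<longrightarrow> small_scale_covering Y M"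
    proof
      fix Y assume "Y \<in> \<Y>"
      then obtain \<Gamma> :: "'g monoid" and \<phi> where gc: "geodesically_complete Y"
        and act: "isometric_action \<Gamma> Y \<phi>" "cocompact_action \<Gamma> Y \<phi>" "proper_action \<Gamma> Y \<phi>"
        using Y by blast
      show "\<exists>M. CAT0 Y \<longrightarrow> small_scale_covering Y M"
      proof (cases "CAT0 Y")
        case True
        obtain M where "small_scale_covering Y M"
          by (rule cocompact_proper_small_scale_covering[OF True gc act])
        then show ?thesis by blast
      qed blast
    qed
    from bchoice[OF this] obtain M where M: "\<forall>Y\<in>\<Y>. CAT0 Y \<longrightarrow> small_scale_covering Y (M Y)" ..
    have "\<exists>Y :: 'a metric. isometric_spaces (F i) Y \<and> small_scale_covering Y (Max (insert 0 (M ` \<Y>)))" if i: "i \<in> I" for i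
    proof -
      obtain Y where Y: "Y \<in> \<Y>" "isometric_spaces (F i) Y" using FY i by blast
      have "small_scale_covering Y (M Y)" using M Y isometric_CAT0[OF Y(2) CF[OF i]] by blast
      moreover have "M Y \<le> Max (insert 0 (M ` \<Y>))" using fin Y(1) by (intro Max_ge) auto
      ultimately have "small_scale_covering Y (Max (insert 0 (M ` \<Y>)))"
        by (rule small_scale_covering_mono)
      then show ?thesis using Y(2) by blast
    qed
    then show ?thesis by blast
  next
    assume "\<exists>N \<ge> 1. \<forall>i \<in> I. CAT0 (F i) \<and> uniformly_locally_doubling (F i) N"
    then obtain N where N: "\<And>i. i \<in> I \<Longrightarrow> uniformly_locally_doubling (F i) N" by blast
    have "isometric_spaces (F i) (F i)" for i
      unfolding isometric_spaces_def by (intro exI[of _ "\<lambda>x. x"]) simp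
    then show ?thesis
      using uniformly_locally_doubling_imp_small_scale_covering[OF N] by blast
  qed
  then obtain M where M: "\<forall>i\<in>I. \<exists>Y :: 'a metric. isometric_spaces (F i) Y \<and> small_scale_covering Y M" ..
  have "poincare_inequality V w A (64 / 3 * real M * \<Lambda>) X"
    if h: "finite V" "\<And>v. v \<in> V \<Longrightarrow> 0 \<le> w v" "sum w V = 1" "A \<subseteq> V \<times> V" "0 \<le> \<Lambda>"
      "poincare_inequality V w A \<Lambda> (euclidean_metric :: real metric)" for V :: "'v set" and w A \<Lambda>
  proof (rule poincare_isometric[OF iso poincare_l2_product[OF pI _ h(4)] h(4)])
    fix i assume i: "i \<in> I"
    then obtain Y :: "'a metric" where Y: "isometric_spaces (F i) Y" "small_scale_covering Y M" using M by blast
    have "poincare_inequality V w A (64 / 3 * real M * \<Lambda>) Y"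
      by (rule CAT0_poincare[OF isometric_CAT0[OF Y(1) CF[OF i]] isometric_mcomplete[OF Y(1) compF[OF i]] Y(2) h])
    then show "poincare_inequality V w A (64 / 3 * real M * \<Lambda>) (F i)"
      by (rule poincare_isometric[OF Y(1) _ h(4)])
  qed
  then have "\<not> embeds_coarsely L V E X" if "expander_sequence L V E" for L and V :: "nat \<Rightarrow> 'v set" and E
    by (rule no_coarse_embedding_of_expanders[of "64 / 3 * real M", rotated]) (use that in auto)
  then show ?thesis by blast
qed

end
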